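(* Let $p,q\in C[0,b]$ be complex-valued. The system of matrix-valued functions $\{\mathcal O_m^{i},\ i=1,2,3,4\}_{m=0}^{\infty}$ is a complete system of solutions of the equation $$BK_x(x,t)+K_t(x,t)B=-Q(x)K(x,t)$$ in $\Omega^+=\{(x,t):0\le x\le b,\ |t|\le x\}$. That is, let $\tilde K:\Omega^+\to\mathcal M_2$ be a solution of this equation (it suffices that $\tilde K$ is a continuous mild solution). Then for any $\varepsilon>0$ there exist $N$ and coefficients $\{a_n,b_n,c_n,d_n\}_{n=0}^{N}\subset\mathbb C$ such that $$\sup_{(x,t)\in\Omega^+}\Bigl|\tilde K(x,t)-\sum_{n=0}^{N}\bigl(a_n\mathcal O_n^1(x,t)+b_n\mathcal O_n^2(x,t)+c_n\mathcal O_n^3(x,t)+d_n\mathcal O_n^4(x,t)\bigr)\Bigr|<\varepsilon .$$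
   Context: $b>0$; $\mathcal M_2$ is the space of complex $2\times2$ matrices with Frobenius norm $|A|=(\sum|a_{ij}|^2)^{1/2}$; $B=\begin{pmatrix}0&1\\ -1&0\end{pmatrix}$, $Q(x)=\begin{pmatrix}p(x)&q(x)\\ q(x)&-p(x)\end{pmatrix}$; $\mathcal P^{\pm}[A]=\frac12(A\pm BAB)$. Mild solution: writing $H(\xi,\eta)=\tilde K(\xi+\eta,\xi-\eta)$ on $\{\xi,\eta\ge0,\ \xi+\eta\le b\}$, $\tilde K$ is a continuous mild solution if $H$ is continuous and $\mathcal P^-[H](\xi,\eta)=\mathcal P^-[H](0,\eta)+\int_0^\xi BQ(u+\eta)\mathcal P^+[H](u,\eta)\,du$, $\ \mathcal P^+[H](\xi,\eta)=\mathcal P^+[H](\xi,0)+\int_0^\eta BQ(\xi+v)\mathcal P^-[H](\xi,v)\,dv$. (Classical solutions are mild solutions.) Formal powers: $(f,g)^T$ is a complex-valued absolutely continuous solution of $g'+pf+qg=0$, $-f'+qf-pg=0$ on $[0,b]$, with $f,g$ non-vanishing on $[0,b]$ and $f(0)g(0)=1$. Put $X^{(0)}(x)=-\int_0^x\frac{p}{f^2}ds$, $Y^{(0)}(x)=1+\int_0^x\frac{p}{g^2}ds$, and for $n\ge0$ $Z^{(n)}(x)=\int_0^x(f^2X^{(n)}+g^2Y^{(n)})ds$, $X^{(n+1)}(x)=-(n+1)\int_0^x\bigl(\frac{p}{f^2}Z^{(n)}+\frac gfY^{(n)}\bigr)ds$, $Y^{(n+1)}(x)=(n+1)\int_0^x\bigl(\frac{p}{g^2}Z^{(n)}+\frac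 fgX^{(n)}\bigr)ds$. The functions $\widetilde X^{(n)},\widetilde Y^{(n)},\widetilde Z^{(n)}$ are defined by the same recurrences starting with $\widetilde X^{(0)}(x)=1+\int_0^x\frac{p}{f^2}ds$, $\widetilde Y^{(0)}(x)=-\int_0^x\frac{p}{g^2}ds$. Define $\Phi_k=(-1)^{(k+1)/2}f(0)(fX^{(k)},gY^{(k)})^T$ for $k$ odd, $\Phi_k=(-1)^{k/2}g(0)(f\widetilde X^{(k)},g\widetilde Y^{(k)})^T$ for $k$ even; $\Psi_k=(-1)^{(k-1)/2}g(0)(f\widetilde X^{(k)},g\widetilde Y^{(k)})^T$ for $k$ odd, $\Psi_k=(-1)^{k/2}f(0)(fX^{(k)},gY^{(k)})^T$ for $k$ even. Generalized wave matrices: for $m\ge0$ (empty sums are $0$) $\mathcal U_{2m-1}(x,t)=\sum_{\text{even }k=0}^m\binom mk\Phi_{m-k}(x)t^k$, $\ \mathcal U_{2m}(x,t)=\sum_{\text{odd }k=1}^m\binom mk\Phi_{m-k}(x)t^k$, $\mathcal V_{2m-1}(x,t)=\sum_{\text{even }k=0}^m\binom mk\Psi_{m-k}(x)t^k$, $\ \mathcal V_{2m}(x,t)=\sum_{\text{odd }k=1}^m\binom mk\Psi_{m-k}(x)t^k$, and (matrices given by their columns) $\mathcal O_m^1=[\,\mathcal U_{2m-1}\ \ -\mathcal V_{2m}\,]$, $\mathcal O_m^2=[\,\mathcal V_{2m}\ \ \mathcal U_{2m-1}\,]$, $\mathcal O_m^3=[\,\mathcal V_{2m-1}\ \ \mathcal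 U_{2m}\,]$, $\mathcal O_m^4=[\,-\mathcal U_{2m}\ \ \mathcal V_{2m-1}\,]$. *)

theory Defs
  imports "HOL-Analysis.Analysis"
begin

section \<open>Matrices\<close>

text \<open>The space of complex two by two matrices is \<^typ>\<open>complex^2^2\<close>, whose library norm is the
  Frobenius norm.\<close>

lemma norm_eq_frobenius:
  fixes A :: "complex^2^2"
  shows "norm A = sqrt (\<Sum>i\<in>UNIV. \<Sum>j\<in>UNIV. (cmod (A $ i $ j))\<^sup>2)"
  by (simp add: norm_vec_def L2_set_def sum_nonneg)

definition matB :: "complex^2^2" where
  "matB = vector [vector [0, 1], vector [-1, 0]]"

definition matQ :: "(real \<Rightarrow> complex) \<Rightarrow> (real \<Rightarrow> complex) \<Rightarrow> real \<Rightarrow> complex^2^2" where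
  "matQ p q x = vector [vector [p x, q x], vector [q x, - p x]]"

definition Pplus :: "complex^2^2 \<Rightarrow> complex^2^2" where
  "Pplus A = (1/2) *\<^sub>R (A + matB ** A ** matB)"

definition Pminus :: "complex^2^2 \<Rightarrow> complex^2^2" where
  "Pminus A = (1/2) *\<^sub>R (A - matB ** A ** matB)"

text \<open>Multiplication of a matrix by a complex scalar; on \<^typ>\<open>complex^2^2\<close> the library operation
  \<open>*s\<close> would take its scalar from \<^typ>\<open>complex^2\<close>.\<close>

definition cscale :: "complex \<Rightarrow> complex^2^2 \<Rightarrow> complex^2^2" where
  "cscale c A = (\<chi> i j. c * A $ i $ j)"

definition columns2 :: "complex^2 \<Rightarrow> complex^2 \<Rightarrow> complex^2^2" where
  "columns2 u v = transpose (vector [u, v])"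


section \<open>Solutions of the matrix equation\<close>

definition OmegaPlus :: "real \<Rightarrow> (real \<times> real) set" where
  "OmegaPlus b = {(x, t). 0 \<le> x \<and> x \<le> b \<and> \<bar>t\<bar> \<le> x}"

text \<open>Classical solutions are continuously differentiable on the closed triangle. The derivative is
  taken within the triangle, so at boundary points it is one-sided; it is unique because the
  triangle is convex with nonempty interior.\<close>

definition classical_solution ::
    "real \<Rightarrow> (real \<Rightarrow> complex) \<Rightarrow> (real \<Rightarrow> complex) \<Rightarrow> (real \<times> real \<Rightarrow> complex^2^2) \<Rightarrow> bool" where
  "classical_solution b p q K \<longleftrightarrow>
     (\<exists>Kx Kt. continuous_on (OmegaPlus b) Kx \<and> continuous_on (OmegaPlus b) Kt \<and>
        (\<forall>(x, t)\<in>OmegaPlus b.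
           (K has_derivative (\<lambda>(h, k). h *\<^sub>R Kx (x, t) + k *\<^sub>R Kt (x, t)))
              (at (x, t) within OmegaPlus b) \<and>
           matB ** Kx (x, t) + Kt (x, t) ** matB = - (matQ p q x ** K (x, t))))"

definition char_triangle :: "real \<Rightarrow> (real \<times> real) set" where
  "char_triangle b = {(\<xi>, \<eta>). 0 \<le> \<xi> \<and> 0 \<le> \<eta> \<and> \<xi> + \<eta> \<le> b}"

definition mild_solution ::
    "real \<Rightarrow> (real \<Rightarrow> complex) \<Rightarrow> (real \<Rightarrow> complex) \<Rightarrow> (real \<times> real \<Rightarrow> complex^2^2) \<Rightarrow> bool" where
  "mild_solution b p q K \<longleftrightarrow>
     (let H = (\<lambda>(\<xi>, \<eta>). K (\<xi> + \<eta>, \<xi> - \<eta>)) in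
        continuous_on (char_triangle b) H \<and>
        (\<forall>(\<xi>, \<eta>)\<in>char_triangle b.
           Pminus (H (\<xi>, \<eta>)) = Pminus (H (0, \<eta>))
             + integral {0..\<xi>} (\<lambda>u. matB ** matQ p q (u + \<eta>) ** Pplus (H (u, \<eta>))) \<and>
           Pplus (H (\<xi>, \<eta>)) = Pplus (H (\<xi>, 0))
             + integral {0..\<eta>} (\<lambda>v. matB ** matQ p q (\<xi> + v) ** Pminus (H (\<xi>, v)))))"

lemmas mat2_simps = vec_eq_iff matrix_matrix_mult_def sum_2 forall_2

lemma linear_Pplus: "linear Pplus"
  by (rule linearI) (simp_all add: Pplus_def matB_def mat2_simps algebra_simps)

lemma linear_Pminus: "linear Pminus"
  by (rule linearI) (simp_all add: Pminus_def matB_def mat2_simps algebra_simps)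

lemma classical_imp_mild:
  assumes "classical_solution b p q K"
  shows "mild_solution b p q K"
proof -
  obtain Kx Kt where
    der: "\<And>x t. (x, t) \<in> OmegaPlus b \<Longrightarrow>
           (K has_derivative (\<lambda>(h, k). h *\<^sub>R Kx (x, t) + k *\<^sub>R Kt (x, t)))
              (at (x, t) within OmegaPlus b)"
    and eq: "\<And>x t. (x, t) \<in> OmegaPlus b \<Longrightarrow>
           matB ** Kx (x, t) + Kt (x, t) ** matB = - (matQ p q x ** K (x, t))"
    using assms unfolding classical_solution_def by fast
  define H where "H = (\<lambda>(\<xi>, \<eta>). K (\<xi> + \<eta>, \<xi> - \<eta>))"
  have Om: "(\<xi> + \<eta>, \<xi> - \<eta>) \<in> OmegaPlus b" if "(\<xi>, \<eta>) \<in> char_triangle b" for \<xi> \<eta>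
    using that by (auto simp: OmegaPlus_def char_triangle_def)
  have "continuous_on (OmegaPlus b) K"
    by (rule has_derivative_continuous_on[where f' = "\<lambda>z (h, k). h *\<^sub>R Kx z + k *\<^sub>R Kt z"])
      (use der in auto)
  then have "continuous_on (char_triangle b) (\<lambda>z. K (fst z + snd z, fst z - snd z))"
    by (rule continuous_on_compose2) (use Om in \<open>auto intro!: continuous_intros\<close>)
  then have cont: "continuous_on (char_triangle b) H"
    by (simp add: H_def case_prod_unfold)
  have alg: "Pminus (Kx (x, t) + Kt (x, t)) = matB ** matQ p q x ** Pplus (K (x, t))"
    "Pplus (Kx (x, t) - Kt (x, t)) = matB ** matQ p q x ** Pminus (K (x, t))"
    if "(x, t) \<in> OmegaPlus b" for x t
  proof -
    note e = eq[OF that]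
    have e11: "Kx (x, t) $ 2 $ 1 - Kt (x, t) $ 1 $ 2
                 = - (p x * K (x, t) $ 1 $ 1 + q x * K (x, t) $ 2 $ 1)"
      and e12: "Kx (x, t) $ 2 $ 2 + Kt (x, t) $ 1 $ 1
                 = - (p x * K (x, t) $ 1 $ 2 + q x * K (x, t) $ 2 $ 2)"
      and e21: "- Kx (x, t) $ 1 $ 1 - Kt (x, t) $ 2 $ 2
                 = - (q x * K (x, t) $ 1 $ 1 - p x * K (x, t) $ 2 $ 1)"
      and e22: "- Kx (x, t) $ 1 $ 2 + Kt (x, t) $ 2 $ 1
                 = - (q x * K (x, t) $ 1 $ 2 - p x * K (x, t) $ 2 $ 2)"
      using arg_cong[OF e, of "\<lambda>M. M $ 1 $ 1"] arg_cong[OF e, of "\<lambda>M. M $ 1 $ 2"]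
        arg_cong[OF e, of "\<lambda>M. M $ 2 $ 1"] arg_cong[OF e, of "\<lambda>M. M $ 2 $ 2"]
      by (simp_all add: matB_def matQ_def matrix_matrix_mult_def sum_2)
    have "Kx (x, t) $ 2 $ 1 = Kt (x, t) $ 1 $ 2 - (p x * K (x, t) $ 1 $ 1 + q x * K (x, t) $ 2 $ 1)"
      "Kx (x, t) $ 2 $ 2 = - Kt (x, t) $ 1 $ 1 - (p x * K (x, t) $ 1 $ 2 + q x * K (x, t) $ 2 $ 2)"
      "Kx (x, t) $ 1 $ 1 = - Kt (x, t) $ 2 $ 2 + (q x * K (x, t) $ 1 $ 1 - p x * K (x, t) $ 2 $ 1)"
      "Kx (x, t) $ 1 $ 2 = Kt (x, t) $ 2 $ 1 + (q x * K (x, t) $ 1 $ 2 - p x * K (x, t) $ 2 $ 2)"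
      using e11 e12 e21 e22 by (algebra)+
    note s = this
    show "Pminus (Kx (x, t) + Kt (x, t)) = matB ** matQ p q x ** Pplus (K (x, t))"
      "Pplus (Kx (x, t) - Kt (x, t)) = matB ** matQ p q x ** Pminus (K (x, t))"
      by (simp_all add: Pminus_def Pplus_def matB_def matQ_def mat2_simps s algebra_simps)
  qed
  have dirder: "((\<lambda>s. K (c s)) has_vector_derivative (fst d *\<^sub>R Kx (c u) + snd d *\<^sub>R Kt (c u)))
         (at u within S)"
    if "(c has_vector_derivative d) (at u within S)" "c ` S \<subseteq> OmegaPlus b" "u \<in> S" for c d u S
  proof -
    have "(K has_derivative (\<lambda>(h, k). h *\<^sub>R Kx (c u) + k *\<^sub>R Kt (c u))) (at (c u) within c ` S)"
      using der[of "fst (c u)" "snd (c u)"] that by (force intro: has_derivative_subset)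
    from vector_derivative_diff_chain_within[OF that(1) this]
    show ?thesis by (simp add: o_def case_prod_unfold)
  qed
  have "Pminus (H (\<xi>, \<eta>)) = Pminus (H (0, \<eta>))
          + integral {0..\<xi>} (\<lambda>u. matB ** matQ p q (u + \<eta>) ** Pplus (H (u, \<eta>)))"
    "Pplus (H (\<xi>, \<eta>)) = Pplus (H (\<xi>, 0))
          + integral {0..\<eta>} (\<lambda>v. matB ** matQ p q (\<xi> + v) ** Pminus (H (\<xi>, v)))"
    if T: "(\<xi>, \<eta>) \<in> char_triangle b" for \<xi> \<eta>
  proof -
    have pos: "0 \<le> \<xi>" "0 \<le> \<eta>" "\<xi> + \<eta> \<le> b" using T by (auto simp: char_triangle_def)
    have "((\<lambda>u. Pminus (H (u, \<eta>))) has_vector_derivative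
             matB ** matQ p q (u + \<eta>) ** Pplus (H (u, \<eta>))) (at u within {0..\<xi>})"
      if u: "u \<in> {0..\<xi>}" for u
    proof -
      have O: "(u + \<eta>, u - \<eta>) \<in> OmegaPlus b"
        using u pos by (intro Om) (auto simp: char_triangle_def)
      have "((\<lambda>u. K (u + \<eta>, u - \<eta>)) has_vector_derivative
               (fst (1::real, 1::real) *\<^sub>R Kx (u + \<eta>, u - \<eta>)
                 + snd (1::real, 1::real) *\<^sub>R Kt (u + \<eta>, u - \<eta>)))
             (at u within {0..\<xi>})"
        using u pos
        by (intro dirder has_vector_derivative_Pair)
          (auto intro!: derivative_eq_intros simp: OmegaPlus_def)
      then have "((\<lambda>u. Pminus (K (u + \<eta>, u - \<eta>))) has_vector_derivative
               Pminus (Kx (u + \<eta>, u - \<eta>) + Kt (u + \<eta>, u - \<eta>))) (at u within {0..\<xi>})"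
        using bounded_linear.has_vector_derivative[OF linear_conv_bounded_linear[THEN iffD1, OF linear_Pminus]]
        by fastforce
      then show ?thesis using alg(1)[OF O] by (simp add: H_def)
    qed
    from fundamental_theorem_of_calculus[OF pos(1) this]
    show "Pminus (H (\<xi>, \<eta>)) = Pminus (H (0, \<eta>))
          + integral {0..\<xi>} (\<lambda>u. matB ** matQ p q (u + \<eta>) ** Pplus (H (u, \<eta>)))"
      by (simp add: integral_unique)
    have "((\<lambda>v. Pplus (H (\<xi>, v))) has_vector_derivative
             matB ** matQ p q (\<xi> + v) ** Pminus (H (\<xi>, v))) (at v within {0..\<eta>})"
      if v: "v \<in> {0..\<eta>}" for v
    proof -
      have O: "(\<xi> + v, \<xi> - v) \<in> OmegaPlus b"
        using v pos by (intro Om) (auto simp: char_triangle_def)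
      have "((\<lambda>v. K (\<xi> + v, \<xi> - v)) has_vector_derivative
               (fst (1::real, -1::real) *\<^sub>R Kx (\<xi> + v, \<xi> - v)
                 + snd (1::real, -1::real) *\<^sub>R Kt (\<xi> + v, \<xi> - v)))
             (at v within {0..\<eta>})"
        using v pos
        by (intro dirder has_vector_derivative_Pair)
          (auto intro!: derivative_eq_intros simp: OmegaPlus_def)
      then have "((\<lambda>v. Pplus (K (\<xi> + v, \<xi> - v))) has_vector_derivative
               Pplus (Kx (\<xi> + v, \<xi> - v) - Kt (\<xi> + v, \<xi> - v))) (at v within {0..\<eta>})"
        using bounded_linear.has_vector_derivative[OF linear_conv_bounded_linear[THEN iffD1, OF linear_Pplus]]
        by fastforce
      then show ?thesis using alg(2)[OF O] by (simp add: H_def)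
    qed
    from fundamental_theorem_of_calculus[OF pos(2) this]
    show "Pplus (H (\<xi>, \<eta>)) = Pplus (H (\<xi>, 0))
          + integral {0..\<eta>} (\<lambda>v. matB ** matQ p q (\<xi> + v) ** Pminus (H (\<xi>, v)))"
      by (simp add: integral_unique)
  qed
  with cont show ?thesis
    unfolding mild_solution_def Let_def H_def[symmetric] by blast
qed


section \<open>Formal powers\<close>

definition abs_cont_on :: "real \<Rightarrow> real \<Rightarrow> (real \<Rightarrow> complex) \<Rightarrow> bool" where
  "abs_cont_on a b f \<longleftrightarrow>
     (\<forall>\<epsilon>>0. \<exists>\<delta>>0. \<forall>(n::nat) u v.
        (\<forall>i<n. a \<le> u i \<and> u i \<le> v i \<and> v i \<le> b) \<and>
        disjoint_family_on (\<lambda>i. {u i<..<v i}) {..<n} \<and>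
        (\<Sum>i<n. v i - u i) < \<delta>
        \<longrightarrow> (\<Sum>i<n. cmod (f (v i) - f (u i))) < \<epsilon>)"

text \<open>As usual for absolutely continuous solutions, the differential equations are required to hold
  almost everywhere.\<close>

definition ac_solution ::
    "real \<Rightarrow> (real \<Rightarrow> complex) \<Rightarrow> (real \<Rightarrow> complex) \<Rightarrow> (real \<Rightarrow> complex) \<Rightarrow> (real \<Rightarrow> complex) \<Rightarrow> bool" where
  "ac_solution b p q f g \<longleftrightarrow>
     abs_cont_on 0 b f \<and> abs_cont_on 0 b g \<and>
     (AE x in lebesgue_on {0..b}. \<exists>f' g'.
        (f has_vector_derivative f') (at x within {0..b}) \<and>
        (g has_vector_derivative g') (at x within {0..b}) \<and>
        g' + p x * f x + q x * g x = 0 \<and>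
        - f' + q x * f x - p x * g x = 0)"

definition formal_Z :: "(real \<Rightarrow> complex) \<Rightarrow> (real \<Rightarrow> complex) \<Rightarrow>
    (real \<Rightarrow> complex) \<Rightarrow> (real \<Rightarrow> complex) \<Rightarrow> real \<Rightarrow> complex" where
  "formal_Z f g X Y x = integral {0..x} (\<lambda>s. (f s)\<^sup>2 * X s + (g s)\<^sup>2 * Y s)"

text \<open>The pair of formal powers of order \<open>n\<close> generated by a given pair of order zero.\<close>

primrec formal_XY :: "(real \<Rightarrow> complex) \<Rightarrow> (real \<Rightarrow> complex) \<Rightarrow> (real \<Rightarrow> complex) \<Rightarrow>
    (real \<Rightarrow> complex) \<times> (real \<Rightarrow> complex) \<Rightarrow> nat \<Rightarrow> (real \<Rightarrow> complex) \<times> (real \<Rightarrow> complex)" where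
  "formal_XY p f g XY0 0 = XY0"
| "formal_XY p f g XY0 (Suc n) =
     (let X = fst (formal_XY p f g XY0 n);
          Y = snd (formal_XY p f g XY0 n);
          Z = formal_Z f g X Y
      in (\<lambda>x. - of_nat (n + 1) * integral {0..x} (\<lambda>s. p s / (f s)\<^sup>2 * Z s + g s / f s * Y s),
          \<lambda>x. of_nat (n + 1) * integral {0..x} (\<lambda>s. p s / (g s)\<^sup>2 * Z s + f s / g s * X s)))"

definition powXY :: "(real \<Rightarrow> complex) \<Rightarrow> (real \<Rightarrow> complex) \<Rightarrow> (real \<Rightarrow> complex) \<Rightarrow>
    nat \<Rightarrow> (real \<Rightarrow> complex) \<times> (real \<Rightarrow> complex)" where
  "powXY p f g = formal_XY p f g
     (\<lambda>x. - integral {0..x} (\<lambda>s. p s / (f s)\<^sup>2), \<lambda>x. 1 + integral {0..x} (\<lambda>s. p s / (g s)\<^sup>2))"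

definition powXY_tilde :: "(real \<Rightarrow> complex) \<Rightarrow> (real \<Rightarrow> complex) \<Rightarrow> (real \<Rightarrow> complex) \<Rightarrow>
    nat \<Rightarrow> (real \<Rightarrow> complex) \<times> (real \<Rightarrow> complex)" where
  "powXY_tilde p f g = formal_XY p f g
     (\<lambda>x. 1 + integral {0..x} (\<lambda>s. p s / (f s)\<^sup>2), \<lambda>x. - integral {0..x} (\<lambda>s. p s / (g s)\<^sup>2))"

text \<open>The vectors \<open>(f X, g Y)\<close> and \<open>(f X~, g Y~)\<close> of order \<open>k\<close>.\<close>

definition fgXY :: "(real \<Rightarrow> complex) \<Rightarrow> (real \<Rightarrow> complex) \<Rightarrow> (real \<Rightarrow> complex) \<Rightarrow>
    nat \<Rightarrow> real \<Rightarrow> complex^2" where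
  "fgXY p f g k x = vector [f x * fst (powXY p f g k) x, g x * snd (powXY p f g k) x]"

definition fgXY_tilde :: "(real \<Rightarrow> complex) \<Rightarrow> (real \<Rightarrow> complex) \<Rightarrow> (real \<Rightarrow> complex) \<Rightarrow>
    nat \<Rightarrow> real \<Rightarrow> complex^2" where
  "fgXY_tilde p f g k x =
     vector [f x * fst (powXY_tilde p f g k) x, g x * snd (powXY_tilde p f g k) x]"

definition Phi :: "(real \<Rightarrow> complex) \<Rightarrow> (real \<Rightarrow> complex) \<Rightarrow> (real \<Rightarrow> complex) \<Rightarrow>
    nat \<Rightarrow> real \<Rightarrow> complex^2" where
  "Phi p f g k x =
     (if odd k then ((-1) ^ ((k + 1) div 2) * f 0) *s fgXY p f g k x
      else ((-1) ^ (k div 2) * g 0) *s fgXY_tilde p f g k x)"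

definition Psi :: "(real \<Rightarrow> complex) \<Rightarrow> (real \<Rightarrow> complex) \<Rightarrow> (real \<Rightarrow> complex) \<Rightarrow>
    nat \<Rightarrow> real \<Rightarrow> complex^2" where
  "Psi p f g k x =
     (if odd k then ((-1) ^ ((k - 1) div 2) * g 0) *s fgXY_tilde p f g k x
      else ((-1) ^ (k div 2) * f 0) *s fgXY p f g k x)"


section \<open>Generalized wave matrices\<close>

text \<open>The part of order \<open>m\<close> with even, respectively odd, powers of \<open>t\<close>. With \<open>F = \<Phi>\<close> these are
  \<open>U\<close> with index \<open>2m - 1\<close> (even) and \<open>2m\<close> (odd); with \<open>F = \<Psi>\<close> they are \<open>V\<close> with the same
  indices. For \<open>m = 0\<close> the former index is \<open>-1\<close>.\<close>

definition wave_even :: "(nat \<Rightarrow> real \<Rightarrow> complex^2) \<Rightarrow> nat \<Rightarrow> real \<Rightarrow> real \<Rightarrow> complex^2" where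
  "wave_even F m x t =
     (\<Sum>k | k \<le> m \<and> even k. (of_nat (m choose k) * complex_of_real t ^ k) *s F (m - k) x)"

definition wave_odd :: "(nat \<Rightarrow> real \<Rightarrow> complex^2) \<Rightarrow> nat \<Rightarrow> real \<Rightarrow> real \<Rightarrow> complex^2" where
  "wave_odd F m x t =
     (\<Sum>k | k \<le> m \<and> odd k. (of_nat (m choose k) * complex_of_real t ^ k) *s F (m - k) x)"

context
  fixes p f g :: "real \<Rightarrow> complex"
begin

definition O1 :: "nat \<Rightarrow> real \<times> real \<Rightarrow> complex^2^2" where
  "O1 m = (\<lambda>(x, t). columns2 (wave_even (Phi p f g) m x t) (- wave_odd (Psi p f g) m x t))"

definition O2 :: "nat \<Rightarrow> real \<times> real \<Rightarrow> complex^2^2" where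
  "O2 m = (\<lambda>(x, t). columns2 (wave_odd (Psi p f g) m x t) (wave_even (Phi p f g) m x t))"

definition O3 :: "nat \<Rightarrow> real \<times> real \<Rightarrow> complex^2^2" where
  "O3 m = (\<lambda>(x, t). columns2 (wave_even (Psi p f g) m x t) (wave_odd (Phi p f g) m x t))"

definition O4 :: "nat \<Rightarrow> real \<times> real \<Rightarrow> complex^2^2" where
  "O4 m = (\<lambda>(x, t). columns2 (- wave_odd (Phi p f g) m x t) (wave_even (Psi p f g) m x t))"

end

end

theory Submission
  imports Defs
begin

text \<open>In characteristic coordinates \<open>x = \<xi> + \<eta>\<close>, \<open>t = \<xi> - \<eta>\<close>, a mild solution is determined by its Goursat
  data \<open>P\<^sup>- H(0, \<eta>)\<close> and \<open>P\<^sup>+ H(\<xi>, 0)\<close>. Extending these data and the potential continuously to the whole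
  line, one solves the Goursat problem on the whole plane and obtains a continuation of the solution across
  the sides \<open>t = \<plusminus>x\<close> of the triangle to the domain of dependence of the segment \<open>x = 0\<close>, \<open>\<bar>t\<bar> \<le> 2b\<close>. There
  the solution depends continuously on its values at \<open>x = 0\<close>. The generalized wave matrices are
  polynomials in \<open>t\<close>, and at \<open>x = 0\<close> the four matrices of order \<open>m\<close> are, up to signs, \<open>t^m\<close> times the four matrix units;
  so the Weierstrass theorem for the values at \<open>x = 0\<close> gives the approximation. They solve the equation
  because the formal powers satisfy \<open>B \<Phi>\<^sub>n' + Q \<Phi>\<^sub>n = - n \<Psi>\<^sub>n\<^sub>-\<^sub>1\<close> and
  \<open>B \<Psi>\<^sub>n' + Q \<Psi>\<^sub>n = n \<Phi>\<^sub>n\<^sub>-\<^sub>1\<close>.\<close>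

section \<open>The Goursat problem on the plane\<close>

text \<open>The triangle meets the line \<open>x = 0\<close> only at the origin, so the values of
  \<open>K\<close> there carry almost no information: its free data sit on the characteristic sides
  \<open>t = x\<close> and \<open>t = -x\<close>, where the wave matrices have no simple form. The
  continuation trades these for data on a segment that is not characteristic. The characteristics
  through a point with \<open>\<bar>t\<bar> \<le> x \<le> b\<close> reach \<open>x = 0\<close> at
  \<open>t - x\<close> and \<open>t + x\<close>, whence the half-length \<open>2 * b\<close>. A mild
  solution need not be differentiable: only \<open>Pminus\<close> of it has a derivative in \<xi>
  and only \<open>Pplus\<close> of it one in \<eta>, and all arguments are confined to these two
  derivatives. A single a priori estimate, \<open>char_solution_stable\<close>, is used twice: with
  zero data on the axes it identifies the continuation with \<open>K\<close> on the triangle, with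
  small data on \<open>x = 0\<close> it gives the approximation. A further obstacle is that
  \<open>f\<close> and \<open>g\<close> solve their equations only almost everywhere. The
  fundamental theorem for absolutely continuous functions removes it, since the coefficients are
  continuous.\<close>

lemma oriented_integral_eq:
  fixes k :: "real \<Rightarrow> 'e::banach"
  assumes J: "\<And>s. s \<in> {0..1} \<Longrightarrow> (J has_vector_derivative k (s * y)) (at (s * y) within (\<lambda>s. s * y) ` {0..1})"
  shows "integral {0..1} (\<lambda>s. y *\<^sub>R k (s * y)) = J y - J 0"
proof -
  have "((\<lambda>s. J (s * y)) has_vector_derivative y *\<^sub>R k (s * y)) (at s within {0..1})" if "s \<in> {0..1}" for s
  proof -
    have "((\<lambda>s. s * y) has_vector_derivative y) (at s within {0..1})"
      by (auto intro!: derivative_eq_intros simp flip: has_real_derivative_iff_has_vector_derivative)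
    from vector_diff_chain_within[OF this J[OF that]] show ?thesis by (simp add: o_def)
  qed
  from fundamental_theorem_of_calculus[OF _ this]
  have "((\<lambda>s. y *\<^sub>R k (s * y)) has_integral J y - J 0) {0..1}" by simp
  then show ?thesis by (rule integral_unique)
qed

text \<open>For \<open>y\<close> near \<open>x\<close> all points \<open>s * y\<close> stay in one
  interval around 0, where a single antiderivative \<open>J\<close> with base point
  \<open>-c\<close> handles both signs of \<open>y\<close>; the integral is
  \<open>J y - J 0\<close>.\<close>

lemma oriented_integral_has_vector_derivative:
  fixes k :: "real \<Rightarrow> 'e::banach"
  assumes k: "continuous_on UNIV k"
  shows "((\<lambda>y. integral {0..1} (\<lambda>s. y *\<^sub>R k (s * y))) has_vector_derivative k x) (at x)"
proof -
  define c where "c = \<bar>x\<bar> + 1"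
  define J where "J = (\<lambda>y. integral {-c..y} k)"
  have J: "(J has_vector_derivative k y) (at y within {-c..c})" if "y \<in> {-c..c}" for y
    unfolding J_def using that continuous_on_subset[OF k]
    by (intro integral_has_vector_derivative) auto
  have eq: "integral {0..1} (\<lambda>s. y *\<^sub>R k (s * y)) = J y - J 0" if y: "y \<in> {-c<..<c}" for y
  proof (rule oriented_integral_eq)
    fix s :: real assume s: "s \<in> {0..1}"
    have sub: "r * y \<in> {-c..c}" if "r \<in> {0..1}" for r
    proof -
      have "\<bar>r * y\<bar> \<le> 1 * c" unfolding abs_mult using that y by (intro mult_mono) auto
      then show ?thesis by auto
    qed
    show "(J has_vector_derivative k (s * y)) (at (s * y) within (\<lambda>s. s * y) ` {0..1})"
      using J[OF sub[OF s]] sub by (auto intro: has_vector_derivative_within_subset)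
  qed
  have x: "x \<in> {-c<..<c}" by (auto simp: c_def)
  have "((\<lambda>y. J y - J 0) has_vector_derivative k x - 0) (at x)"
    using J[of x] x at_within_interior[of x "{-c..c}"]
    by (intro has_vector_derivative_diff) (auto intro!: derivative_eq_intros)
  then show ?thesis
    using has_vector_derivative_transform_within_open[where S = "{-c<..<c}" and f = "\<lambda>y. J y - J 0"] x eq
    by (metis (no_types, lifting) diff_zero open_greaterThanLessThan)
qed

text \<open>The exponential majorant integrates to itself divided by \<open>L\<close>. This factor
  \<open>1 / L\<close>, small for large \<open>L\<close>, is what makes the weighted contraction
  possible.\<close>

lemma oriented_integral_bound:
  fixes k :: "real \<Rightarrow> 'e::banach"
  assumes k: "continuous_on UNIV k" and L: "0 < L" and "0 \<le> C"
    and bd: "\<And>u. norm (k u) \<le> C * exp (L * \<bar>u\<bar>)"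
  shows "norm (integral {0..1} (\<lambda>s. y *\<^sub>R k (s * y))) \<le> C / L * exp (L * \<bar>y\<bar>)"
proof -
  have c: "continuous_on {0..1} (\<lambda>s. y *\<^sub>R k (s * y))"
    by (intro continuous_intros continuous_on_compose2[OF k]) auto
  have FT: "((\<lambda>s. \<bar>y\<bar> * (C * exp (L * (s * \<bar>y\<bar>)))) has_integral
      C / L * exp (L * (1 * \<bar>y\<bar>)) - C / L * exp (L * (0 * \<bar>y\<bar>))) {0..1}"
    using L by (intro fundamental_theorem_of_calculus)
      (auto intro!: derivative_eq_intros simp: has_real_derivative_iff_has_vector_derivative[symmetric])
  have "norm (integral {0..1} (\<lambda>s. y *\<^sub>R k (s * y))) \<le> integral {0..1} (\<lambda>s. \<bar>y\<bar> * (C * exp (L * (s * \<bar>y\<bar>))))"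
  proof (rule integral_norm_bound_integral)
    show "norm (y *\<^sub>R k (s * y)) \<le> \<bar>y\<bar> * (C * exp (L * (s * \<bar>y\<bar>)))" if "s \<in> {0..1}" for s
      using bd[of "s * y"] that by (auto simp: abs_mult intro!: mult_left_mono)
  qed (use c FT in \<open>auto intro: integrable_continuous_interval\<close>)
  also have "\<dots> = C / L * exp (L * \<bar>y\<bar>) - C / L"
    using integral_unique[OF FT] by simp
  also have "\<dots> \<le> C / L * exp (L * \<bar>y\<bar>)" using L \<open>0 \<le> C\<close> by simp
  finally show ?thesis .
qed

lemma continuous_on_oriented_integral:
  fixes k :: "real \<Rightarrow> 'a::metric_space \<Rightarrow> 'e::banach" and x :: "'a \<Rightarrow> real"
  assumes k: "continuous_on UNIV (\<lambda>(u, z). k u z)" and x: "continuous_on UNIV x"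
  shows "continuous_on UNIV (\<lambda>z. integral {0..1} (\<lambda>s. x z *\<^sub>R k (s * x z) z))"
proof -
  have "continuous_on (UNIV \<times> cbox 0 (1::real)) (\<lambda>(z, s). x z *\<^sub>R k (s * x z) z)"
    unfolding case_prod_unfold
    by (intro continuous_intros continuous_on_compose2[OF x]
        continuous_on_compose2[OF k[unfolded case_prod_unfold], where f = "\<lambda>w. (snd w * x (fst w), fst w)", simplified]) auto
  from integral_continuous_on_param[OF this] show ?thesis by simp
qed

text \<open>The integral over \<open>{0..1}\<close> of \<open>\<xi> k(s \<xi>)\<close> is the oriented integral of \<open>k\<close> from \<open>0\<close> to \<open>\<xi>\<close>, for either sign of
  \<open>\<xi>\<close>.\<close>

definition goursat_op ::
  "(real \<times> real \<Rightarrow> 'e \<Rightarrow> 'e) \<Rightarrow> (real \<times> real \<Rightarrow> 'e \<Rightarrow> 'e) \<Rightarrow> (real \<times> real \<Rightarrow> 'e) \<Rightarrow> real \<times> real \<Rightarrow> 'e::banach"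
  where "goursat_op k l H = (\<lambda>(\<xi>, \<eta>). integral {0..1} (\<lambda>s. \<xi> *\<^sub>R k (s * \<xi>, \<eta>) (H (s * \<xi>, \<eta>)))
     + integral {0..1} (\<lambda>s. \<eta> *\<^sub>R l (\<xi>, s * \<eta>) (H (\<xi>, s * \<eta>))))"

text \<open>The operator is a contraction for the sup norm with weight \<open>exp (- L (\<bar>\<xi>\<bar> + \<bar>\<eta>\<bar>))\<close>, \<open>L\<close> large.\<close>

lemma goursat_solution_exists:
  fixes k l :: "real \<times> real \<Rightarrow> 'e \<Rightarrow> 'e::banach" and h :: "real \<times> real \<Rightarrow> 'e"
  assumes lin: "\<And>z. linear (k z)" "\<And>z. linear (l z)"
    and cont: "\<And>H. continuous_on UNIV H \<Longrightarrow> continuous_on UNIV (\<lambda>z. k z (H z))"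
      "\<And>H. continuous_on UNIV H \<Longrightarrow> continuous_on UNIV (\<lambda>z. l z (H z))"
    and bd: "\<And>z X. norm (k z X) \<le> M * norm X" "\<And>z X. norm (l z X) \<le> M * norm X"
    and h: "continuous_on UNIV h" "bounded (range h)"
  obtains H where "continuous_on UNIV H" "\<And>z. H z = h z + goursat_op k l H z"
proof -
  \<comment> \<open>Each of the two integrals contributes a factor \<open>\<bar>M\<bar> / L\<close>;
    with this choice their sum is at most \<open>1 / 2\<close>.\<close>
  define L where "L = 4 * \<bar>M\<bar> + 1"
  have L: "0 < L" by (auto simp: L_def)
  define w where "w = (\<lambda>z::real \<times> real. exp (L * (\<bar>fst z\<bar> + \<bar>snd z\<bar>)))"
  have w: "continuous_on UNIV w" "\<And>z. 0 < w z" "\<And>z. w z \<noteq> 0" "\<And>z. 1 \<le> w z" "\<And>z. inverse (w z) \<le> 1"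
    unfolding w_def using L by (auto intro!: continuous_intros simp flip: exp_minus)
  have gc: "continuous_on UNIV (goursat_op k l H)" if H: "continuous_on UNIV H" for H
  proof -
    have "continuous_on UNIV (\<lambda>z. integral {0..1} (\<lambda>s. fst z *\<^sub>R k (s * fst z, snd z) (H (s * fst z, snd z)))
       + integral {0..1} (\<lambda>s. snd z *\<^sub>R l (fst z, s * snd z) (H (fst z, s * snd z))))"
    proof (rule continuous_on_add)
      show "continuous_on UNIV (\<lambda>z. integral {0..1} (\<lambda>s. fst z *\<^sub>R k (s * fst z, snd z) (H (s * fst z, snd z))))"
        by (rule continuous_on_oriented_integral[where k = "\<lambda>u z. k (u, snd z) (H (u, snd z))"])
          (auto intro!: continuous_intros continuous_on_compose2[OF cont(1)[OF H]] simp: case_prod_unfold)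
      show "continuous_on UNIV (\<lambda>z. integral {0..1} (\<lambda>s. snd z *\<^sub>R l (fst z, s * snd z) (H (fst z, s * snd z))))"
        by (rule continuous_on_oriented_integral[where k = "\<lambda>u z. l (fst z, u) (H (fst z, u))"])
          (auto intro!: continuous_intros continuous_on_compose2[OF cont(2)[OF H]] simp: case_prod_unfold)
    qed
    then show ?thesis by (simp add: goursat_op_def case_prod_unfold)
  qed
  have slice: "continuous_on UNIV (\<lambda>u. k (u, \<eta>) (H (u, \<eta>)))" "continuous_on UNIV (\<lambda>v. l (\<xi>, v) (H (\<xi>, v)))"
    if H: "continuous_on UNIV H" for H \<xi> \<eta>
    by (auto intro!: continuous_intros continuous_on_compose2[OF cont(1)[OF H]] continuous_on_compose2[OF cont(2)[OF H]])
  \<comment> \<open>This weighted estimate gives both that the fixed point map preserves boundedness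
    and, through \<open>gdiff\<close>, that it contracts by \<open>1 / 2\<close>.\<close>
  have gb: "norm (goursat_op k l H z) \<le> C / 2 * w z"
    if H: "continuous_on UNIV H" and C: "\<And>z. norm (H z) \<le> C * w z" for H C z
  proof -
    obtain \<xi> \<eta> where z: "z = (\<xi>, \<eta>)" by force
    have "0 \<le> C * w 0" using C[of 0] norm_ge_zero order_trans by blast
    then have C0: "0 \<le> C" using w(2)[of 0] by (simp add: zero_le_mult_iff)
    have kl: "norm (k z (H z)) \<le> \<bar>M\<bar> * C * w z" "norm (l z (H z)) \<le> \<bar>M\<bar> * C * w z" for z
    proof -
      have "M * norm (H z) \<le> \<bar>M\<bar> * (C * w z)" using C[of z] by (intro mult_mono) auto
      then show "norm (k z (H z)) \<le> \<bar>M\<bar> * C * w z" "norm (l z (H z)) \<le> \<bar>M\<bar> * C * w z"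
        using bd[of z "H z"] by (simp_all add: mult.assoc)
    qed
    have 1: "norm (integral {0..1} (\<lambda>s. \<xi> *\<^sub>R k (s * \<xi>, \<eta>) (H (s * \<xi>, \<eta>)))) \<le> (\<bar>M\<bar> * C * exp (L * \<bar>\<eta>\<bar>)) / L * exp (L * \<bar>\<xi>\<bar>)"
      using kl(1) C0 by (intro oriented_integral_bound[OF slice(1)[OF H] L]) (auto simp: w_def algebra_simps exp_add)
    have 2: "norm (integral {0..1} (\<lambda>s. \<eta> *\<^sub>R l (\<xi>, s * \<eta>) (H (\<xi>, s * \<eta>)))) \<le> (\<bar>M\<bar> * C * exp (L * \<bar>\<xi>\<bar>)) / L * exp (L * \<bar>\<eta>\<bar>)"
      by (intro oriented_integral_bound[OF slice(2)[OF H] L] order_trans[OF kl(2)])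
        (use C0 in \<open>simp_all add: w_def algebra_simps exp_add\<close>)
    have "norm (goursat_op k l H z) \<le> (\<bar>M\<bar> * C) / L * w z + (\<bar>M\<bar> * C) / L * w z"
      unfolding goursat_op_def z prod.case
      by (rule norm_triangle_mono) (use 1 2 in \<open>simp_all add: w_def exp_add algebra_simps\<close>)
    also have "\<dots> = (2 * \<bar>M\<bar> / L) * (C * w z)" by (simp add: field_simps)
    also have "\<dots> \<le> (1/2) * (C * w z)"
      using C0 w(2)[of z] L by (intro mult_right_mono) (auto simp: L_def field_simps)
    finally show ?thesis by simp
  qed
  have gdiff: "goursat_op k l (\<lambda>z. H z - H' z) z = goursat_op k l H z - goursat_op k l H' z"
    if H: "continuous_on UNIV H" "continuous_on UNIV H'" for H H' z
  proof -
    have i: "(\<lambda>s. x *\<^sub>R k (s * x, y) (G (s * x, y))) integrable_on {0..1}"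
      "(\<lambda>s. y *\<^sub>R l (x, s * y) (G (x, s * y))) integrable_on {0..1}" if "continuous_on UNIV G" for G x y
      by (auto intro!: integrable_continuous_interval continuous_intros continuous_on_compose2[OF slice(1)[OF that]]
          continuous_on_compose2[OF slice(2)[OF that]])
    show ?thesis
      by (simp add: goursat_op_def case_prod_unfold linear_diff[OF lin(1)] linear_diff[OF lin(2)] scaleR_diff_right
          integral_diff i H del: integral_mult_right integral_mult_left integral_cmul)
  qed
  obtain C0 where C0: "\<And>z. norm (h z) \<le> C0" using h(2) by (auto simp: bounded_iff)
  \<comment> \<open>The unknown is rescaled to \<open>G = H / w\<close>: the weighted norm becomes
    the sup norm of the complete space of bounded continuous functions, although \<open>H\<close>
    itself may grow exponentially.\<close>
  define T where "T = (\<lambda>G z. inverse (w z) *\<^sub>R (h z + goursat_op k l (\<lambda>z. w z *\<^sub>R G z) z))"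
  define TT :: "((real \<times> real) \<Rightarrow>\<^sub>C 'e) \<Rightarrow> ((real \<times> real) \<Rightarrow>\<^sub>C 'e)" where "TT = (\<lambda>G. Bcontfun (T (apply_bcontfun G)))"
  have wG: "continuous_on UNIV (\<lambda>z. w z *\<^sub>R apply_bcontfun G z)" for G :: "(real \<times> real) \<Rightarrow>\<^sub>C 'e"
    by (intro continuous_intros w(1)) auto
  have wB: "norm (w z *\<^sub>R apply_bcontfun G z) \<le> norm G * w z" for G :: "(real \<times> real) \<Rightarrow>\<^sub>C 'e" and z
    using norm_bounded[of G z] w(2)[of z] by (simp add: mult.commute)
  have mem: "T (apply_bcontfun G) \<in> bcontfun" for G
  proof (rule bcontfun_normI)
    show "continuous_on UNIV (T (apply_bcontfun G))"
      unfolding T_def by (intro continuous_intros w(1) gc wG h(1)) (use w in auto)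
    show "norm (T (apply_bcontfun G) z) \<le> C0 + norm G / 2" for z
    proof -
      have "norm (T (apply_bcontfun G) z) \<le> inverse (w z) * (C0 + norm G / 2 * w z)"
        unfolding T_def norm_scaleR using w(2)[of z]
        by (intro mult_mono norm_triangle_mono C0 gb[OF wG wB]) auto
      also have "\<dots> = inverse (w z) * C0 + norm G / 2" using w(3)[of z] by (simp add: field_simps)
      also have "inverse (w z) * C0 \<le> 1 * C0" using C0[of z] w(5)[of z]
        by (intro mult_right_mono) (use norm_ge_zero order_trans in blast)+
      finally show ?thesis by simp
    qed
  qed
  have TT: "apply_bcontfun (TT G) = T (apply_bcontfun G)" for G
    unfolding TT_def using mem by (simp add: Bcontfun_inverse)
  have "\<exists>!G. TT G = G"
  proof (rule banach_fix_type)
    show "\<forall>G G'. dist (TT G) (TT G') \<le> 1/2 * dist G G'"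
    proof (intro allI dist_bound)
      fix G G' :: "(real \<times> real) \<Rightarrow>\<^sub>C 'e" and z
      have d: "norm (w z *\<^sub>R apply_bcontfun G z - w z *\<^sub>R apply_bcontfun G' z) \<le> dist G G' * w z" for z
        using wB[of z "G - G'"] by (simp add: dist_norm scaleR_diff_right)
      have "norm (goursat_op k l (\<lambda>z. w z *\<^sub>R apply_bcontfun G z - w z *\<^sub>R apply_bcontfun G' z) z) \<le> dist G G' / 2 * w z"
        by (intro gb d continuous_on_diff wG)
      then have "inverse (w z) * norm (goursat_op k l (\<lambda>z. w z *\<^sub>R apply_bcontfun G z) z - goursat_op k l (\<lambda>z. w z *\<^sub>R apply_bcontfun G' z) z)
          \<le> dist G G' / 2"
        using w(2)[of z] by (simp add: gdiff wG field_simps)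
      then show "dist (apply_bcontfun (TT G) z) (apply_bcontfun (TT G') z) \<le> 1/2 * dist G G'"
        using w(2)[of z] by (simp add: TT T_def dist_norm flip: scaleR_diff_right)
    qed
  qed auto
  then obtain G where G: "TT G = G" by blast
  show ?thesis
  proof (rule that)
    show "continuous_on UNIV (\<lambda>z. w z *\<^sub>R apply_bcontfun G z)" by (rule wG)
    show "w z *\<^sub>R apply_bcontfun G z = h z + goursat_op k l (\<lambda>z. w z *\<^sub>R apply_bcontfun G z) z" for z
      using arg_cong[OF G, of "\<lambda>G. w z *\<^sub>R apply_bcontfun G z"] w(3)[of z] by (simp add: TT T_def)
  qed
qed

section \<open>Solutions along characteristics\<close>

lemma Pplus_plus_Pminus: "Pminus A + Pplus A = A"
  by (simp add: Pplus_def Pminus_def scaleR_add_right[symmetric] scaleR_2[symmetric])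

lemma Pplus_idem: "Pplus (Pplus A) = Pplus A" and Pminus_idem: "Pminus (Pminus A) = Pminus A"
  and Pplus_Pminus: "Pplus (Pminus A) = 0" and Pminus_Pplus: "Pminus (Pplus A) = 0"
  by (simp_all add: Pminus_def Pplus_def matB_def mat2_simps algebra_simps)

abbreviation potential :: "(real \<Rightarrow> complex) \<Rightarrow> (real \<Rightarrow> complex) \<Rightarrow> real \<Rightarrow> complex^2^2" where
  "potential p q x \<equiv> matB ** matQ p q x"

text \<open>\<open>matB\<close> anticommutes with \<open>matQ p q x\<close>, so multiplication by
  the potential anticommutes with the conjugation \<open>X \<mapsto> matB ** X ** matB\<close>. This
  conjugation is the identity on the range of \<open>Pplus\<close> and minus the identity on that of
  \<open>Pminus\<close>; hence the potential maps each range into the other.\<close>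

lemma potential_Pplus:
  "Pminus (potential p q x ** Pplus A) = potential p q x ** Pplus A" "Pplus (potential p q x ** Pplus A) = 0"
  and potential_Pminus:
  "Pplus (potential p q x ** Pminus A) = potential p q x ** Pminus A" "Pminus (potential p q x ** Pminus A) = 0"
  by (simp_all add: Pminus_def Pplus_def matB_def matQ_def mat2_simps)
    (simp_all add: scaleR_conv_of_real[where 'a = complex] algebra_simps)

lemma bounded_linear_Pplus: "bounded_linear Pplus" and bounded_linear_Pminus: "bounded_linear Pminus"
  using linear_Pplus linear_Pminus by (simp_all add: linear_conv_bounded_linear)

lemma bounded_bilinear_matrix_matrix_mult:
  "bounded_bilinear ((**) :: complex^2^2 \<Rightarrow> complex^2^2 \<Rightarrow> complex^2^2)"
  by (subst bilinear_conv_bounded_bilinear[symmetric])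
    (auto simp: bilinear_def mat2_simps algebra_simps intro!: linearI)

lemma continuous_on_potential:
  assumes "continuous_on S p" "continuous_on S q"
  shows "continuous_on S (potential p q)"
proof -
  have "potential p q = (\<lambda>x. \<chi> i j. if i = 1 then (if j = 1 then q x else - p x) else (if j = 1 then - p x else - q x))"
    by (auto simp: fun_eq_iff matB_def matQ_def mat2_simps)
  moreover have "continuous_on S (\<lambda>x. if c then q x else - p x)" "continuous_on S (\<lambda>x. if c then - p x else - q x)" for c
    by (cases c; use assms in \<open>auto intro!: continuous_intros\<close>)+
  then have "continuous_on S (\<lambda>x. if c' then (if c then q x else - p x) else (if c then - p x else - q x))" for c c'
    by (cases c') auto
  ultimately show ?thesis by (simp only:) (intro continuous_on_vec_lambda)
qed

text \<open>One constant serves both projections. The set \<open>S\<close> is kept general because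
  the estimate is applied on the whole line as well as on \<open>{0..b}\<close>.\<close>

lemma potential_bound:
  assumes "bounded (potential p q ` S)"
  obtains M where "\<And>x X. x \<in> S \<Longrightarrow> norm (potential p q x ** Pplus X) \<le> M * norm X"
    "\<And>x X. x \<in> S \<Longrightarrow> norm (potential p q x ** Pminus X) \<le> M * norm X" "0 \<le> M"
proof -
  obtain C where C: "\<And>x. x \<in> S \<Longrightarrow> norm (potential p q x) \<le> C" and C0: "0 < C"
    using assms unfolding bounded_pos by auto
  obtain B where B: "0 < B" "\<And>X Y. norm (X ** (Y::complex^2^2) :: complex^2^2) \<le> norm X * norm Y * B"
    using bounded_bilinear.pos_bounded[OF bounded_bilinear_matrix_matrix_mult] by metis
  obtain K1 where K1: "0 < K1" "\<And>X. norm (Pplus X) \<le> norm X * K1"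
    using bounded_linear.pos_bounded[OF bounded_linear_Pplus] by metis
  obtain K2 where K2: "0 < K2" "\<And>X. norm (Pminus X) \<le> norm X * K2"
    using bounded_linear.pos_bounded[OF bounded_linear_Pminus] by metis
  define M where "M = C * max K1 K2 * B"
  have *: "norm (potential p q x ** Y) \<le> M * norm X"
    if x: "x \<in> S" and Y: "norm Y \<le> norm X * max K1 K2" for x X and Y :: "complex^2^2"
  proof -
    have "norm (potential p q x ** Y) \<le> norm (potential p q x) * norm Y * B" by (rule B)
    also have "\<dots> \<le> C * (norm X * max K1 K2) * B"
      using C[OF x] Y B C0 by (intro mult_right_mono mult_mono) auto
    finally show ?thesis by (simp add: M_def mult_ac)
  qed
  have "norm (Pplus X) \<le> norm X * max K1 K2" "norm (Pminus X) \<le> norm X * max K1 K2" for X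
    using K1(2)[of X] K2(2)[of X] mult_left_mono[of K1 "max K1 K2" "norm X"] mult_left_mono[of K2 "max K1 K2" "norm X"]
    by auto
  then show ?thesis using B C0 K1 K2 by (intro that[of M] *) (auto simp: M_def)
qed

text \<open>The mild equations differentiated along characteristic segments, so that the starting point of a
  segment is arbitrary.\<close>

definition char_solution ::
    "(real \<times> real) set \<Rightarrow> (real \<Rightarrow> complex^2^2) \<Rightarrow> (real \<times> real \<Rightarrow> complex^2^2) \<Rightarrow> bool" where
  "char_solution S A H \<longleftrightarrow> continuous_on S H \<and>
    (\<forall>\<xi>0 \<xi> \<eta>. {\<xi>0..\<xi>} \<times> {\<eta>} \<subseteq> S \<longrightarrow> (\<forall>u\<in>{\<xi>0..\<xi>}.
      ((\<lambda>u. Pminus (H (u, \<eta>))) has_vector_derivative A (u + \<eta>) ** Pplus (H (u, \<eta>))) (at u within {\<xi>0..\<xi>}))) \<and>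
    (\<forall>\<eta>0 \<xi> \<eta>. {\<xi>} \<times> {\<eta>0..\<eta>} \<subseteq> S \<longrightarrow> (\<forall>v\<in>{\<eta>0..\<eta>}.
      ((\<lambda>v. Pplus (H (\<xi>, v))) has_vector_derivative A (\<xi> + v) ** Pminus (H (\<xi>, v))) (at v within {\<eta>0..\<eta>})))"

lemma char_solutionD:
  assumes "char_solution S A H"
  shows "continuous_on S H"
    "{\<xi>0..\<xi>} \<times> {\<eta>} \<subseteq> S \<Longrightarrow> u \<in> {\<xi>0..\<xi>} \<Longrightarrow>
      ((\<lambda>u. Pminus (H (u, \<eta>))) has_vector_derivative A (u + \<eta>) ** Pplus (H (u, \<eta>))) (at u within {\<xi>0..\<xi>})"
    "{\<xi>} \<times> {\<eta>0..\<eta>} \<subseteq> S \<Longrightarrow> v \<in> {\<eta>0..\<eta>} \<Longrightarrow>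
      ((\<lambda>v. Pplus (H (\<xi>, v))) has_vector_derivative A (\<xi> + v) ** Pminus (H (\<xi>, v))) (at v within {\<eta>0..\<eta>})"
  using assms unfolding char_solution_def by blast+

section \<open>Linearity and localization of characteristic solutions\<close>

lemma char_solution_diff:
  assumes "char_solution S A H" "char_solution S A H'"
  shows "char_solution S A (\<lambda>z. H z - H' z)"
proof -
  note simps = linear_diff[OF linear_Pplus] linear_diff[OF linear_Pminus]
    bounded_bilinear.diff_right[OF bounded_bilinear_matrix_matrix_mult]
  show ?thesis
    unfolding char_solution_def simps
    by (intro conjI allI impI ballI continuous_on_diff has_vector_derivative_diff
        char_solutionD[OF assms(1)] char_solutionD[OF assms(2)])
qed

text \<open>A segment inside \<open>T\<close> reads the coefficient only at the sums of coordinates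
  of its points, so the coefficient may change elsewhere. This is the way back from the clamped
  potential to the original one.\<close>

lemma char_solution_restrict:
  assumes "char_solution S A H" "T \<subseteq> S" "\<And>x y. (x, y) \<in> T \<Longrightarrow> A (x + y) = A' (x + y)"
  shows "char_solution T A' H"
proof -
  have "A' (u + \<eta>) = A (u + \<eta>)" if "{\<xi>0..\<xi>} \<times> {\<eta>} \<subseteq> T" "u \<in> {\<xi>0..\<xi>}" for \<xi>0 \<xi> \<eta> u
    using assms(3)[of u \<eta>] subsetD[OF that(1), of "(u, \<eta>)"] that(2) by simp
  moreover have "A' (\<xi> + v) = A (\<xi> + v)" if "{\<xi>} \<times> {\<eta>0..\<eta>} \<subseteq> T" "v \<in> {\<eta>0..\<eta>}" for \<xi> \<eta>0 \<eta> v
    using assms(3)[of \<xi> v] subsetD[OF that(1), of "(\<xi>, v)"] that(2) by simp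
  moreover have "continuous_on T H" using char_solutionD(1)[OF assms(1)] assms(2) continuous_on_subset by blast
  moreover note sub = subset_trans[OF _ assms(2)]
  ultimately show ?thesis
    unfolding char_solution_def
    by (intro conjI allI impI ballI) (simp_all add: char_solutionD(2,3)[OF assms(1)] sub)
qed

section \<open>Stability with respect to the data\<close>

lemma increment_bound_exp:
  fixes f :: "real \<Rightarrow> 'a::real_normed_vector"
  assumes "a \<le> x" and L: "0 < L"
    and der: "\<And>u. u \<in> {a..x} \<Longrightarrow> (f has_vector_derivative f' u) (at u within {a..x})"
    and bd: "\<And>u. u \<in> {a..x} \<Longrightarrow> norm (f' u) \<le> C * exp (L * (u + c))" and "0 \<le> C"
  shows "norm (f x - f a) \<le> C / L * exp (L * (x + c))"
proof (cases "a = x")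
  case False
  have phi: "((\<lambda>u. C / L * exp (L * (u + c))) has_vector_derivative C * exp (L * (u + c))) (at u)" for u
    using L by (auto intro!: derivative_eq_intros simp: has_real_derivative_iff_has_vector_derivative[symmetric])
  \<comment> \<open>Mean value inequality with \<open>C / L * exp (L * (u + c))\<close> as majorant;
    in the applications \<open>c\<close> is the coordinate that stays fixed along the
    characteristic.\<close>
  have "norm (f x - f a) \<le> C / L * exp (L * (x + c)) - C / L * exp (L * (a + c))"
  proof (rule differentiable_bound_general[where f = f and f' = f'])
    show "a < x" using False \<open>a \<le> x\<close> by simp
    show "continuous_on {a..x} f" using der continuous_on_vector_derivative by blast
    show "(f has_vector_derivative f' u) (at u)" if "a < u" "u < x" for u
      using der[of u] that by (auto simp: at_within_Icc_at)
  qed (use L bd phi in \<open>auto intro!: continuous_intros\<close>)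
  also have "\<dots> \<le> C / L * exp (L * (x + c))" using L \<open>0 \<le> C\<close> by simp
  finally show ?thesis .
qed (use L \<open>0 \<le> C\<close> in simp)

text \<open>Gronwall argument at a maximum: where
  \<open>norm (W z) * exp (- L * (\<xi> + \<eta>))\<close> takes its largest value \<open>m\<close>,
  integrating back to the data yields \<open>m \<le> 2 * \<delta> + m / 2\<close>. The assumptions
  \<open>left\<close> and \<open>down\<close> ask that each point be joined inside \<open>S\<close>
  to small data by a horizontal and by a vertical segment; this covers data on the coordinate axes
  as well as on the line \<open>\<xi> + \<eta> = 0\<close>.\<close>

lemma char_solution_stable:
  assumes W: "char_solution S A W" and S: "compact S" "\<And>u v. (u, v) \<in> S \<Longrightarrow> u + v \<in> {0..b}"
    and M: "\<And>x X. x \<in> {0..b} \<Longrightarrow> norm (A x ** Pplus X) \<le> M * norm X"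
      "\<And>x X. x \<in> {0..b} \<Longrightarrow> norm (A x ** Pminus X) \<le> M * norm X" "0 \<le> M"
    and left: "\<And>\<xi> \<eta>. (\<xi>, \<eta>) \<in> S \<Longrightarrow> \<exists>\<xi>0\<le>\<xi>. {\<xi>0..\<xi>} \<times> {\<eta>} \<subseteq> S \<and> norm (Pminus (W (\<xi>0, \<eta>))) \<le> \<delta>"
    and down: "\<And>\<xi> \<eta>. (\<xi>, \<eta>) \<in> S \<Longrightarrow> \<exists>\<eta>0\<le>\<eta>. {\<xi>} \<times> {\<eta>0..\<eta>} \<subseteq> S \<and> norm (Pplus (W (\<xi>, \<eta>0))) \<le> \<delta>"
    and z: "z \<in> S"
  shows "norm (W z) \<le> 4 * \<delta> * exp ((4 * M + 1) * b)"
proof -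
  \<comment> \<open>Chosen so that \<open>2 * M / L \<le> 1 / 2\<close>, with one
    \<open>M / L\<close> for each projection.\<close>
  define L where "L = 4 * M + 1"
  have L: "0 < L" using M(3) by (simp add: L_def)
  have d0: "0 \<le> \<delta>" using left[of "fst z" "snd z"] z norm_ge_zero order_trans by (metis prod.collapse)
  define r where "r = (\<lambda>z. norm (W z) * exp (- L * (fst z + snd z)))"
  have "continuous_on S r" unfolding r_def by (intro continuous_intros char_solutionD(1)[OF W])
  then obtain z0 where z0: "z0 \<in> S" "\<And>y. y \<in> S \<Longrightarrow> r y \<le> r z0"
    using continuous_attains_sup[OF S(1)] z by blast
  define m where "m = r z0"
  have m0: "0 \<le> m" by (simp add: m_def r_def)
  have Wm: "norm (W (u, v)) \<le> m * exp (L * (u + v))" if "(u, v) \<in> S" for u v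
  proof -
    have "norm (W (u, v)) = r (u, v) * exp (L * (u + v))" by (simp add: r_def flip: exp_add)
    then show ?thesis using z0(2)[OF that] by (simp add: m_def mult_right_mono)
  qed
  have incr: "M * norm (W (u, v)) \<le> M * m * exp (L * (u + v))" if "(u, v) \<in> S" for u v
    using mult_left_mono[OF Wm[OF that] M(3)] by (simp add: mult_ac)
  have key: "norm (W (\<xi>, \<eta>)) \<le> 2 * \<delta> + m / 2 * exp (L * (\<xi> + \<eta>))" if Z: "(\<xi>, \<eta>) \<in> S" for \<xi> \<eta>
  proof -
    obtain \<xi>0 where 1: "\<xi>0 \<le> \<xi>" "{\<xi>0..\<xi>} \<times> {\<eta>} \<subseteq> S" "norm (Pminus (W (\<xi>0, \<eta>))) \<le> \<delta>" using left[OF Z] by blast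
    obtain \<eta>0 where 2: "\<eta>0 \<le> \<eta>" "{\<xi>} \<times> {\<eta>0..\<eta>} \<subseteq> S" "norm (Pplus (W (\<xi>, \<eta>0))) \<le> \<delta>" using down[OF Z] by blast
    have "norm (Pminus (W (\<xi>, \<eta>)) - Pminus (W (\<xi>0, \<eta>))) \<le> (M * m) / L * exp (L * (\<xi> + \<eta>))"
    proof (rule increment_bound_exp[OF 1(1) L char_solutionD(2)[OF W 1(2)]])
      fix u assume u: "u \<in> {\<xi>0..\<xi>}"
      then have us: "(u, \<eta>) \<in> S" using 1(2) by auto
      show "norm (A (u + \<eta>) ** Pplus (W (u, \<eta>))) \<le> (M * m) * exp (L * (u + \<eta>))"
        using M(1)[OF S(2)[OF us]] incr[OF us] order_trans by blast
    qed (auto intro: mult_nonneg_nonneg[OF M(3) m0])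
    moreover have "norm (Pplus (W (\<xi>, \<eta>)) - Pplus (W (\<xi>, \<eta>0))) \<le> (M * m) / L * exp (L * (\<eta> + \<xi>))"
    proof (rule increment_bound_exp[OF 2(1) L char_solutionD(3)[OF W 2(2)]])
      fix v assume v: "v \<in> {\<eta>0..\<eta>}"
      then have vs: "(\<xi>, v) \<in> S" using 2(2) by auto
      show "norm (A (\<xi> + v) ** Pminus (W (\<xi>, v))) \<le> (M * m) * exp (L * (v + \<xi>))"
        using order_trans[OF M(2)[OF S(2)[OF vs]] incr[OF vs]] by (simp add: add.commute)
    qed (auto intro: mult_nonneg_nonneg[OF M(3) m0])
    ultimately have *: "norm (Pminus (W (\<xi>, \<eta>))) \<le> \<delta> + (M * m) / L * exp (L * (\<xi> + \<eta>))"
      "norm (Pplus (W (\<xi>, \<eta>))) \<le> \<delta> + (M * m) / L * exp (L * (\<xi> + \<eta>))"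
      using 1(3) 2(3) norm_triangle_sub[of "Pminus (W (\<xi>, \<eta>))" "Pminus (W (\<xi>0, \<eta>))"]
        norm_triangle_sub[of "Pplus (W (\<xi>, \<eta>))" "Pplus (W (\<xi>, \<eta>0))"] by (simp_all add: add.commute)
    have "norm (W (\<xi>, \<eta>)) \<le> norm (Pminus (W (\<xi>, \<eta>))) + norm (Pplus (W (\<xi>, \<eta>)))"
      by (metis Pplus_plus_Pminus norm_triangle_ineq)
    also have "\<dots> \<le> 2 * \<delta> + 2 * ((M * m) / L * exp (L * (\<xi> + \<eta>)))"
      unfolding mult_2 using add_mono[OF *] by (simp only: add_ac)
    also have "2 * ((M * m) / L * exp (L * (\<xi> + \<eta>))) = 2 * M / L * (m * exp (L * (\<xi> + \<eta>)))" by simp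
    also have "2 * M / L * (m * exp (L * (\<xi> + \<eta>))) \<le> 1 / 2 * (m * exp (L * (\<xi> + \<eta>)))"
      using m0 L M(3) by (intro mult_right_mono) (auto simp: L_def field_simps)
    finally show ?thesis by simp
  qed
  obtain u v where uv: "z0 = (u, v)" by force
  have "0 \<le> L * (u + v)" using S(2)[of u v] z0(1) L by (simp add: uv)
  then have e: "exp (- L * (u + v)) \<le> 1" by simp
  \<comment> \<open>The bound \<open>key\<close> at the maximum point, multiplied by the weight: its
    second term becomes \<open>m / 2\<close> and can be absorbed on the left.\<close>
  have "m \<le> (2 * \<delta> + m / 2 * exp (L * (u + v))) * exp (- L * (u + v))"
    using key[of u v] z0(1) by (simp add: m_def r_def uv mult_right_mono)
  also have "\<dots> = 2 * \<delta> * exp (- L * (u + v)) + m / 2"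
  proof -
    have "exp (L * (u + v)) * exp (- L * (u + v)) = 1" by (simp flip: exp_add)
    then show ?thesis by (simp add: distrib_right mult.assoc)
  qed
  also have "\<dots> \<le> 2 * \<delta> * 1 + m / 2" using d0 by (intro add_right_mono mult_left_mono e) auto
  finally have "m \<le> 4 * \<delta>" by simp
  obtain \<xi> \<eta> where Z: "z = (\<xi>, \<eta>)" by force
  have "norm (W z) \<le> m * exp (L * (\<xi> + \<eta>))" using Wm z by (simp add: Z)
  also have "\<dots> \<le> 4 * \<delta> * exp (L * b)"
    using \<open>m \<le> 4 * \<delta>\<close> m0 d0 S(2)[of \<xi> \<eta>] z L by (intro mult_mono) (auto simp: Z)
  finally show ?thesis by (simp add: L_def)
qed

text \<open>The two data prescribe complementary projections, so they cannot conflict at the origin.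
  Boundedness of potential and data provides the uniform constants for the contraction on the whole
  plane.\<close>

lemma char_solution_goursat:
  assumes pq: "continuous_on UNIV p" "continuous_on UNIV q" "bounded (range (potential p q))"
    and data: "continuous_on UNIV \<psi>" "bounded (range \<psi>)" "continuous_on UNIV \<phi>" "bounded (range \<phi>)"
  obtains H where "char_solution UNIV (potential p q) H"
    "\<And>\<eta>. Pminus (H (0, \<eta>)) = Pminus (\<psi> \<eta>)" "\<And>\<xi>. Pplus (H (\<xi>, 0)) = Pplus (\<phi> \<xi>)"
proof -
  define A where "A = potential p q"
  have A: "continuous_on UNIV A" unfolding A_def by (intro continuous_on_potential pq)
  obtain M where M: "\<And>x X. norm (A x ** Pplus X) \<le> M * norm X" "\<And>x X. norm (A x ** Pminus X) \<le> M * norm X"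
    using potential_bound[OF pq(3)] unfolding A_def by (metis UNIV_I)
  define k where "k = (\<lambda>z X. A (fst z + snd z) ** Pplus X)"
  define l where "l = (\<lambda>z X. A (fst z + snd z) ** Pminus X)"
  define h where "h = (\<lambda>z. Pminus (\<psi> (snd z)) + Pplus (\<phi> (fst z)))"
  note mm = bounded_bilinear_matrix_matrix_mult
  note PcI = bounded_linear.continuous_on[OF bounded_linear_Pplus] bounded_linear.continuous_on[OF bounded_linear_Pminus]
    bounded_bilinear.continuous_on[OF mm]
  have kl_cont: "continuous_on UNIV (\<lambda>z. k z (H z))" "continuous_on UNIV (\<lambda>z. l z (H z))"
    if H: "continuous_on UNIV H" for H
    unfolding k_def l_def by (intro PcI H continuous_on_compose2[OF A] continuous_intros; simp)+
  have hb: "bounded (range h)"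
  proof -
    have "bounded (Pminus ` range \<psi>)" "bounded (Pplus ` range \<phi>)"
      using bounded_linear_image data bounded_linear_Pminus bounded_linear_Pplus by blast+
    then have "bounded (range (\<lambda>z::real \<times> real. Pminus (\<psi> (snd z))))" "bounded (range (\<lambda>z::real \<times> real. Pplus (\<phi> (fst z))))"
      by (elim bounded_subset; auto)+
    then show ?thesis unfolding h_def by (rule bounded_plus_comp)
  qed
  obtain H where H: "continuous_on UNIV H" "\<And>z. H z = h z + goursat_op k l H z"
  proof (rule goursat_solution_exists[of k l M h])
    show "linear (k z)" "linear (l z)" for z
      unfolding k_def l_def
      using linear_compose[OF linear_Pplus] linear_compose[OF linear_Pminus]
        bounded_linear.linear[OF bounded_bilinear.bounded_linear_right[OF mm]] by (auto simp: o_def)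
    show "continuous_on UNIV h"
      unfolding h_def
      by (intro continuous_intros PcI continuous_on_compose2[OF data(1)] continuous_on_compose2[OF data(3)]) auto
  qed (use kl_cont M hb in \<open>auto simp: k_def l_def\<close>)
  have kl_slice: "continuous_on UNIV (\<lambda>u. k (u, \<eta>) (H (u, \<eta>)))" "continuous_on UNIV (\<lambda>v. l (\<xi>, v) (H (\<xi>, v)))" for \<xi> \<eta>
    by (auto intro!: continuous_intros continuous_on_compose2[OF kl_cont(1)[OF H(1)]] continuous_on_compose2[OF kl_cont(2)[OF H(1)]])
  have int: "(\<lambda>s. x *\<^sub>R k (s * x, y) (H (s * x, y))) integrable_on {0..1}"
    "(\<lambda>s. y *\<^sub>R l (x, s * y) (H (x, s * y))) integrable_on {0..1}" for x y
    by (auto intro!: integrable_continuous_interval continuous_intros continuous_on_compose2[OF kl_slice(1)]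
        continuous_on_compose2[OF kl_slice(2)])
  have Pk: "Pminus (k z X) = k z X" "Pplus (k z X) = 0" and Pl: "Pplus (l z X) = l z X" "Pminus (l z X) = 0" for z X
    by (simp_all add: k_def l_def A_def potential_Pplus potential_Pminus)
  note Plin = linear_add[OF linear_Pplus] linear_add[OF linear_Pminus] linear_0[OF linear_Pplus] linear_0[OF linear_Pminus]
    linear_scale[OF linear_Pplus] linear_scale[OF linear_Pminus]
  have Pint: "Pplus (integral {0..1} f) = integral {0..1} (\<lambda>s. Pplus (f s))"
    "Pminus (integral {0..1} f) = integral {0..1} (\<lambda>s. Pminus (f s))" if "f integrable_on {0..1}" for f :: "real \<Rightarrow> _"
    using integral_linear[OF that bounded_linear_Pplus] integral_linear[OF that bounded_linear_Pminus] by (simp_all add: o_def)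
  \<comment> \<open>Projecting the fixed point equation: \<open>k\<close> takes values in the range
    of \<open>Pminus\<close> and \<open>l\<close> in that of \<open>Pplus\<close>, so exactly one
    datum and one integral survive.\<close>
  have Hm: "Pminus (H (\<xi>, \<eta>)) = Pminus (\<psi> \<eta>) + integral {0..1} (\<lambda>s. \<xi> *\<^sub>R k (s * \<xi>, \<eta>) (H (s * \<xi>, \<eta>)))" for \<xi> \<eta>
    by (subst H(2)) (simp add: h_def goursat_op_def Plin Pint[OF int(1)] Pint[OF int(2)] Pk Pl Pminus_idem Pminus_Pplus del: integral_mult_right integral_mult_left integral_cmul)
  have Hp: "Pplus (H (\<xi>, \<eta>)) = Pplus (\<phi> \<xi>) + integral {0..1} (\<lambda>s. \<eta> *\<^sub>R l (\<xi>, s * \<eta>) (H (\<xi>, s * \<eta>)))" for \<xi> \<eta>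
    by (subst H(2)) (simp add: h_def goursat_op_def Plin Pint[OF int(1)] Pint[OF int(2)] Pk Pl Pplus_idem Pplus_Pminus del: integral_mult_right integral_mult_left integral_cmul)
  have "((\<lambda>u. Pminus (H (u, \<eta>))) has_vector_derivative A (u + \<eta>) ** Pplus (H (u, \<eta>))) (at u)" for u \<eta>
    unfolding Hm
    using has_vector_derivative_add[OF has_vector_derivative_const oriented_integral_has_vector_derivative[OF kl_slice(1)]]
    by (simp add: k_def Hp)
  moreover have "((\<lambda>v. Pplus (H (\<xi>, v))) has_vector_derivative A (\<xi> + v) ** Pminus (H (\<xi>, v))) (at v)" for \<xi> v
    unfolding Hp
    using has_vector_derivative_add[OF has_vector_derivative_const oriented_integral_has_vector_derivative[OF kl_slice(2)]]
    by (simp add: l_def Hm)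
  ultimately have "char_solution UNIV A H"
    unfolding char_solution_def using H(1) by (auto intro: has_vector_derivative_at_within)
  then show ?thesis using Hm[of 0] Hp[of _ 0] by (intro that[of H]) (auto simp: A_def)
qed

text \<open>The integrands of the mild equations are continuous, so the integrals can be
  differentiated. A horizontal or vertical segment in the triangle extends within it to the
  coordinate axis, where the mild equation starts.\<close>

lemma mild_imp_char_solution:
  assumes "mild_solution b p q K" and pq: "continuous_on {0..b} p" "continuous_on {0..b} q"
  shows "char_solution (char_triangle b) (potential p q) (\<lambda>(\<xi>, \<eta>). K (\<xi> + \<eta>, \<xi> - \<eta>))"
proof -
  define H where "H = (\<lambda>(\<xi>, \<eta>). K (\<xi> + \<eta>, \<xi> - \<eta>))"
  have H: "continuous_on (char_triangle b) H"
    "\<And>\<xi> \<eta>. (\<xi>, \<eta>) \<in> char_triangle b \<Longrightarrow> Pminus (H (\<xi>, \<eta>)) = Pminus (H (0, \<eta>))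
             + integral {0..\<xi>} (\<lambda>u. potential p q (u + \<eta>) ** Pplus (H (u, \<eta>)))"
    "\<And>\<xi> \<eta>. (\<xi>, \<eta>) \<in> char_triangle b \<Longrightarrow> Pplus (H (\<xi>, \<eta>)) = Pplus (H (\<xi>, 0))
             + integral {0..\<eta>} (\<lambda>v. potential p q (\<xi> + v) ** Pminus (H (\<xi>, v)))"
    using assms(1) unfolding mild_solution_def Let_def H_def[symmetric] by blast+
  note PcI = bounded_linear.continuous_on[OF bounded_linear_Pplus] bounded_linear.continuous_on[OF bounded_linear_Pminus]
    bounded_bilinear.continuous_on[OF bounded_bilinear_matrix_matrix_mult]
  have pot: "continuous_on {0..b} (potential p q)" by (intro continuous_on_potential pq)
  have "((\<lambda>u. Pminus (H (u, \<eta>))) has_vector_derivative potential p q (u + \<eta>) ** Pplus (H (u, \<eta>))) (at u within {\<xi>0..\<xi>})"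
    if sub: "{\<xi>0..\<xi>} \<times> {\<eta>} \<subseteq> char_triangle b" and u: "u \<in> {\<xi>0..\<xi>}" for \<xi>0 \<xi> \<eta> u
  proof -
    have pos: "0 \<le> \<xi>0" "0 \<le> \<eta>" "\<xi> + \<eta> \<le> b"
      using subsetD[OF sub, of "(\<xi>0, \<eta>)"] subsetD[OF sub, of "(\<xi>, \<eta>)"] u by (auto simp: char_triangle_def)
    have "continuous_on {0..\<xi>} (\<lambda>u. potential p q (u + \<eta>) ** Pplus (H (u, \<eta>)))"
      using pos by (intro PcI continuous_on_compose2[OF pot] continuous_on_compose2[OF H(1)] continuous_intros)
        (auto simp: char_triangle_def)
    from integral_has_vector_derivative[OF this, of u]
    have "((\<lambda>u. Pminus (H (0, \<eta>)) + integral {0..u} (\<lambda>u. potential p q (u + \<eta>) ** Pplus (H (u, \<eta>))))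
       has_vector_derivative 0 + potential p q (u + \<eta>) ** Pplus (H (u, \<eta>))) (at u within {0..\<xi>})"
      using u pos by (intro has_vector_derivative_add has_vector_derivative_const) auto
    then have "((\<lambda>u. Pminus (H (u, \<eta>))) has_vector_derivative 0 + potential p q (u + \<eta>) ** Pplus (H (u, \<eta>))) (at u within {0..\<xi>})"
      by (rule has_vector_derivative_transform[rotated 2]) (use u pos in \<open>auto simp: char_triangle_def intro!: H(2)\<close>)
    then show ?thesis using pos by (auto intro: has_vector_derivative_within_subset)
  qed
  moreover have "((\<lambda>v. Pplus (H (\<xi>, v))) has_vector_derivative potential p q (\<xi> + v) ** Pminus (H (\<xi>, v))) (at v within {\<eta>0..\<eta>})"
    if sub: "{\<xi>} \<times> {\<eta>0..\<eta>} \<subseteq> char_triangle b" and v: "v \<in> {\<eta>0..\<eta>}" for \<xi> \<eta>0 \<eta> v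
  proof -
    have pos: "0 \<le> \<eta>0" "0 \<le> \<xi>" "\<xi> + \<eta> \<le> b"
      using subsetD[OF sub, of "(\<xi>, \<eta>0)"] subsetD[OF sub, of "(\<xi>, \<eta>)"] v by (auto simp: char_triangle_def)
    have "continuous_on {0..\<eta>} (\<lambda>v. potential p q (\<xi> + v) ** Pminus (H (\<xi>, v)))"
      using pos by (intro PcI continuous_on_compose2[OF pot] continuous_on_compose2[OF H(1)] continuous_intros)
        (auto simp: char_triangle_def)
    from integral_has_vector_derivative[OF this, of v]
    have "((\<lambda>v. Pplus (H (\<xi>, 0)) + integral {0..v} (\<lambda>v. potential p q (\<xi> + v) ** Pminus (H (\<xi>, v))))
       has_vector_derivative 0 + potential p q (\<xi> + v) ** Pminus (H (\<xi>, v))) (at v within {0..\<eta>})"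
      using v pos by (intro has_vector_derivative_add has_vector_derivative_const) auto
    then have "((\<lambda>v. Pplus (H (\<xi>, v))) has_vector_derivative 0 + potential p q (\<xi> + v) ** Pminus (H (\<xi>, v))) (at v within {0..\<eta>})"
      by (rule has_vector_derivative_transform[rotated 2]) (use v pos in \<open>auto simp: char_triangle_def intro!: H(3)\<close>)
    then show ?thesis using pos by (auto intro: has_vector_derivative_within_subset)
  qed
  ultimately show ?thesis
    unfolding H_def[symmetric] char_solution_def using H(1) by blast
qed

section \<open>Absolutely continuous solutions\<close>

text \<open>A division is a finite set of closed intervals, whereas absolute continuity is phrased
  with indexed families whose open intervals are disjoint; enumerating the set translates between
  the two.\<close>

lemma abs_cont_on_sum_bound:
  assumes "abs_cont_on a b h" "0 < \<epsilon>"
  obtains \<delta> where "0 < \<delta>"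
    "\<And>D. finite D \<Longrightarrow> (\<And>K. K \<in> D \<Longrightarrow> \<exists>u v. K = {u..v} \<and> u \<le> v \<and> K \<subseteq> {a..b}) \<Longrightarrow>
       pairwise (\<lambda>K L. interior K \<inter> interior L = {}) D \<Longrightarrow> (\<Sum>K\<in>D. measure lborel K) < \<delta> \<Longrightarrow>
       (\<Sum>K\<in>D. cmod (h (Sup K) - h (Inf K))) < \<epsilon>"
proof -
  obtain \<delta> where \<delta>: "0 < \<delta>" and H: "\<And>(n::nat) u v.
        (\<forall>i<n. a \<le> u i \<and> u i \<le> v i \<and> v i \<le> b) \<Longrightarrow>
        disjoint_family_on (\<lambda>i. {u i<..<v i}) {..<n} \<Longrightarrow>
        (\<Sum>i<n. v i - u i) < \<delta> \<Longrightarrow> (\<Sum>i<n. cmod (h (v i) - h (u i))) < \<epsilon>"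
    using assms unfolding abs_cont_on_def by meson
  show ?thesis
  proof (rule that[OF \<delta>])
    fix D :: "real set set"
    assume D: "finite D" "\<And>K. K \<in> D \<Longrightarrow> \<exists>u v. K = {u..v} \<and> u \<le> v \<and> K \<subseteq> {a..b}"
      "pairwise (\<lambda>K L. interior K \<inter> interior L = {}) D" "(\<Sum>K\<in>D. measure lborel K) < \<delta>"
    obtain k where k: "bij_betw k {..<card D} D"
      using ex_bij_betw_nat_finite[OF D(1)] by (auto simp: lessThan_atLeast0)
    have K: "k i \<in> D" if "i < card D" for i using k that by (auto simp: bij_betw_def)
    define u where "u = (\<lambda>i. Inf (k i))"
    define v where "v = (\<lambda>i. Sup (k i))"
    have uv: "k i = {u i..v i} \<and> a \<le> u i \<and> u i \<le> v i \<and> v i \<le> b" if "i < card D" for i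
      using D(2)[OF K[OF that]] by (auto simp: u_def v_def)
    have "(\<Sum>i<card D. cmod (h (v i) - h (u i))) < \<epsilon>"
    proof (rule H)
      show "disjoint_family_on (\<lambda>i. {u i<..<v i}) {..<card D}"
        unfolding disjoint_family_on_def
      proof (intro ballI impI)
        fix i j assume ij: "i \<in> {..<card D}" "j \<in> {..<card D}" "i \<noteq> j"
        then have "k i \<noteq> k j" using k by (auto simp: bij_betw_def inj_on_def)
        then have "interior (k i) \<inter> interior (k j) = {}"
          using D(3) K ij by (auto simp: pairwise_def)
        then show "{u i<..<v i} \<inter> {u j<..<v j} = {}" using uv ij by (metis interior_atLeastAtMost_real lessThan_iff)
      qed
      have "(\<Sum>i<card D. v i - u i) = (\<Sum>i<card D. measure lborel (k i))" using uv by (intro sum.cong) auto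
      also have "\<dots> = (\<Sum>K\<in>D. measure lborel K)" by (rule sum.reindex_bij_betw[OF k])
      finally show "(\<Sum>i<card D. v i - u i) < \<delta>" using D(4) by simp
    qed (use uv in auto)
    moreover have "(\<Sum>i<card D. cmod (h (v i) - h (u i))) = (\<Sum>K\<in>D. cmod (h (Sup K) - h (Inf K)))"
      unfolding u_def v_def by (rule sum.reindex_bij_betw[OF k, of "\<lambda>K. cmod (h (Sup K) - h (Inf K))"])
    ultimately show "(\<Sum>K\<in>D. cmod (h (Sup K) - h (Inf K))) < \<epsilon>" by simp
  qed
qed

lemma tagged_division_real_interval:
  assumes "p tagged_division_of {a..b::real}" "(x, K) \<in> p"
  shows "\<exists>u v. K = {u..v} \<and> u \<le> v \<and> u \<le> x \<and> x \<le> v \<and> K \<subseteq> {a..b}"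
  using tagged_division_ofD(2-4)[OF assms] by (force simp: cbox_interval)

text \<open>Choose a gauge that confines intervals tagged in the exceptional null set to an open set of small
  measure, where absolute continuity controls the increments, and that makes the first order error over
  the remaining intervals at most \<open>\<epsilon>\<close> times the length.\<close>

lemma abs_cont_on_fundamental_theorem:
  assumes h: "abs_cont_on a b h" and N: "negligible N" and ab: "a \<le> b"
    and der: "\<And>x. x \<in> {a..b} - N \<Longrightarrow> (h has_vector_derivative h' x) (at x within {a..b})"
  shows "(h' has_integral h b - h a) {a..b}"
proof -
  \<comment> \<open>With the value 0 on the null set, an interval tagged there contributes to the
    error only the increment of \<open>h\<close>. A spike argument restores \<open>h'\<close> at the
    end.\<close>
  define k where "k = (\<lambda>x. if x \<in> N then 0 else h' x)"
  have "(k has_integral h b - h a) {a..b}"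
    unfolding has_integral_real
  proof (intro allI impI)
    fix e :: real assume e: "0 < e"
    \<comment> \<open>The intervals with good tags cost \<open>\<epsilon> * (b - a)\<close>, those
      tagged in \<open>N\<close> cost \<epsilon>; together this is \<open>e\<close>, also for
      \<open>a = b\<close>.\<close>
    define \<epsilon> where "\<epsilon> = e / (b - a + 1)"
    have \<epsilon>: "0 < \<epsilon>" using e ab by (simp add: \<epsilon>_def)
    have \<epsilon>_sum: "\<epsilon> * (b - a) + \<epsilon> = e"
    proof -
      have "\<epsilon> * (b - a) + \<epsilon> = \<epsilon> * (b - a + 1)" by (simp add: algebra_simps)
      then show ?thesis using ab by (simp add: \<epsilon>_def)
    qed
    obtain \<delta> where \<delta>: "0 < \<delta>"
      "\<And>D. finite D \<Longrightarrow> (\<And>K. K \<in> D \<Longrightarrow> \<exists>u v. K = {u..v} \<and> u \<le> v \<and> K \<subseteq> {a..b}) \<Longrightarrow>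
       pairwise (\<lambda>K L. interior K \<inter> interior L = {}) D \<Longrightarrow> (\<Sum>K\<in>D. measure lborel K) < \<delta> \<Longrightarrow>
       (\<Sum>K\<in>D. cmod (h (Sup K) - h (Inf K))) < \<epsilon>"
      using abs_cont_on_sum_bound[OF h \<epsilon>] by blast
    have "N \<in> sets lebesgue" using N negligible_imp_sets by blast
    then obtain U where U: "open U" "N \<subseteq> U" "U - N \<in> lmeasurable" "emeasure lebesgue (U - N) < ennreal \<delta>"
      using sets_lebesgue_outer_open[OF _ \<delta>(1)] by blast
    have UN: "U = (U - N) \<union> N" using U(2) by blast
    have Um: "U \<in> lmeasurable" "measure lebesgue U < \<delta>"
    proof -
      show 1: "U \<in> lmeasurable"
        using U(3) N UN negligible_imp_measurable by (metis fmeasurable.Un)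
      have "measure lebesgue U = measure lebesgue (U - N)"
        using N U(3) by (metis UN measure_Un_null_set negligible_iff_null_sets fmeasurableD)
      also have "\<dots> < \<delta>" using U(3,4) \<delta>(1) by (simp add: emeasure_eq_measure2 ennreal_less_iff)
      finally show "measure lebesgue U < \<delta>" .
    qed
    have "\<exists>r>0. (x \<in> N \<longrightarrow> ball x r \<subseteq> U) \<and>
       (x \<in> {a..b} - N \<longrightarrow> (\<forall>y\<in>{a..b}. \<bar>y - x\<bar> < r \<longrightarrow> cmod (h y - h x - (y - x) *\<^sub>R k x) \<le> \<epsilon> * \<bar>y - x\<bar>))" for x
    proof (cases "x \<in> N")
      case True
      then show ?thesis using U(1,2) by (auto simp: open_contains_ball)
    next
      case False
      show ?thesis
      proof (cases "x \<in> {a..b}")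
        case True
        with der[of x] False have "(h has_derivative (\<lambda>y. y *\<^sub>R k x)) (at x within {a..b})"
          by (simp add: has_vector_derivative_def k_def)
        then obtain d where "0 < d" "\<forall>y\<in>{a..b}. norm (y - x) < d \<longrightarrow> norm (h y - h x - (y - x) *\<^sub>R k x) \<le> \<epsilon> * norm (y - x)"
          using \<epsilon> unfolding has_derivative_within_alt by blast
        then show ?thesis using False by (intro exI[of _ d]) auto
      qed (use False in \<open>auto intro: exI[of _ 1]\<close>)
    qed
    then obtain r where r: "\<And>x. 0 < r x" "\<And>x. x \<in> N \<Longrightarrow> ball x (r x) \<subseteq> U"
      "\<And>x y. x \<in> {a..b} - N \<Longrightarrow> y \<in> {a..b} \<Longrightarrow> \<bar>y - x\<bar> < r x \<Longrightarrow> cmod (h y - h x - (y - x) *\<^sub>R k x) \<le> \<epsilon> * \<bar>y - x\<bar>"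
      by metis
    show "\<exists>\<gamma>. gauge \<gamma> \<and> (\<forall>D. D tagged_division_of {a..b} \<and> \<gamma> fine D \<longrightarrow>
        cmod ((\<Sum>(x, K)\<in>D. measure lborel K *\<^sub>R k x) - (h b - h a)) < e)"
    proof (intro exI[of _ "\<lambda>x. ball x (r x)"] conjI allI impI; (elim conjE)?)
      show "gauge (\<lambda>x. ball x (r x))" using r(1) by (auto simp: gauge_def)
      fix p assume p: "p tagged_division_of {a..b}" "(\<lambda>x. ball x (r x)) fine p"
      note fin = tagged_division_of_finite[OF p(1)]
      have pI: "\<exists>u v. K = {u..v} \<and> u \<le> v \<and> u \<le> x \<and> x \<le> v \<and> K \<subseteq> {a..b}" if "(x, K) \<in> p" for x K
        by (rule tagged_division_real_interval[OF p(1) that])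
      \<comment> \<open>Restricted to nondegenerate intervals: having nonempty interior, each of
        them determines its tag, so a sum over tagged pairs becomes a sum over a set of
        intervals.\<close>
      define pN where "pN = {(x, K) \<in> p. x \<in> N \<and> measure lborel K \<noteq> 0}"
      have pN: "pN \<subseteq> p" "finite pN" using fin by (auto simp: pN_def intro: finite_subset)
      have disj: "interior K \<inter> interior L = {}" if "(x, K) \<in> p" "(y, L) \<in> p" "(x, K) \<noteq> (y, L)" for x y K L
        using tagged_division_ofD(5)[OF p(1) that] .
      have inj: "inj_on snd pN"
      proof (rule inj_onI)
        fix z w assume zw: "z \<in> pN" "w \<in> pN" "snd z = snd w"
        obtain x y K where K: "z = (x, K)" "w = (y, K)" using zw(3) by (metis prod.collapse)
        then have p: "(x, K) \<in> p" "(y, K) \<in> p" using zw pN(1) by auto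
        have "interior K \<noteq> {}" using pI[OF p(1)] zw(1) K by (auto simp: pN_def split: if_splits)
        then show "z = w" using disj[OF p] K by auto
      qed
      have sumN: "(\<Sum>(x, K)\<in>pN. cmod (h (Sup K) - h (Inf K))) < \<epsilon>"
      proof -
        have DI: "\<exists>u v. K = {u..v} \<and> u \<le> v \<and> K \<subseteq> {a..b}" if "K \<in> snd ` pN" for K
        proof -
          obtain x where "(x, K) \<in> p" using \<open>K \<in> snd ` pN\<close> pN(1) by auto
          from pI[OF this] show ?thesis by blast
        qed
        have D: "(\<Sum>K\<in>snd ` pN. cmod (h (Sup K) - h (Inf K))) < \<epsilon>"
        proof (rule \<delta>(2))
          show "\<exists>u v. K = {u..v} \<and> u \<le> v \<and> K \<subseteq> {a..b}" if "K \<in> snd ` pN" for K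
            using DI[OF that] .
          show pw: "pairwise (\<lambda>K L. interior K \<inter> interior L = {}) (snd ` pN)"
          proof (rule pairwiseI)
            fix K L assume "K \<in> snd ` pN" "L \<in> snd ` pN" "K \<noteq> L"
            moreover obtain x y where "(x, K) \<in> p" "(y, L) \<in> p"
              using calculation(1,2) subsetD[OF pN(1)] by (metis imageE prod.collapse)
            ultimately show "interior K \<inter> interior L = {}" using disj by blast
          qed
          have lm: "K \<in> lmeasurable" "K \<subseteq> U" if "K \<in> snd ` pN" for K
          proof -
            obtain x where x: "(x, K) \<in> p" "x \<in> N" using \<open>K \<in> snd ` pN\<close> by (auto simp: pN_def)
            show "K \<in> lmeasurable" using pI[OF x(1)] by auto
            show "K \<subseteq> U" using p(2) x r(2)[OF x(2)] unfolding fine_def by blast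
          qed
          have "measure lborel K = measure lebesgue K" if K: "K \<in> snd ` pN" for K
          proof -
            obtain u v where "K = {u..v}" using DI[OF K] by blast
            then show ?thesis by (simp add: measure_completion)
          qed
          then have "(\<Sum>K\<in>snd ` pN. measure lborel K) = (\<Sum>K\<in>snd ` pN. measure lebesgue K)"
            by (rule sum.cong[OF refl])
          \<comment> \<open>Two of the intervals overlap in a convex set with empty interior, which
            is negligible, so the lengths add up to the measure of a subset of
            \<open>U\<close>.\<close>
          also have "\<dots> = measure lebesgue (\<Union>K\<in>snd ` pN. K)"
          proof (rule measure_negligible_finite_Union_image[symmetric])
            show "pairwise (\<lambda>K L. negligible (K \<inter> L)) (snd ` pN)"
              unfolding pairwise_def
            proof (intro ballI impI)
              fix K L assume KL: "K \<in> snd ` pN" "L \<in> snd ` pN" "K \<noteq> L"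
              have "convex (K \<inter> L)" using DI[OF KL(1)] DI[OF KL(2)] by (auto intro!: convex_Int)
              moreover have "interior (K \<inter> L) = {}" using pw KL by (auto simp: pairwise_def)
              ultimately show "negligible (K \<inter> L)"
                using negligible_convex_interior by blast
            qed
          qed (use pN lm in auto)
          also have "\<dots> \<le> measure lebesgue U"
            using lm Um(1) pN(2) by (intro measure_mono_fmeasurable) (auto intro!: fmeasurableD fmeasurable.finite_UN)
          finally show "(\<Sum>K\<in>snd ` pN. measure lborel K) < \<delta>" using Um(2) by simp
        qed (use pN in auto)
        then show ?thesis by (simp add: sum.reindex[OF inj] case_prod_unfold o_def)
      qed
      define E where "E = (\<lambda>(x, K). measure lborel K *\<^sub>R k x - (h (Sup K) - h (Inf K)))"
      have "(\<Sum>(x, K)\<in>p. measure lborel K *\<^sub>R k x) - (h b - h a) = (\<Sum>z\<in>p. E z)"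
        using additive_tagged_division_1[OF ab p(1), of h] by (simp add: E_def case_prod_unfold sum_subtractf)
      also have "cmod \<dots> \<le> (\<Sum>z\<in>p. cmod (E z))" by (rule norm_sum)
      also have "\<dots> = (\<Sum>z\<in>p - pN. cmod (E z)) + (\<Sum>z\<in>pN. cmod (E z))"
        by (rule sum.subset_diff[OF pN(1) fin])
      also have "(\<Sum>z\<in>pN. cmod (E z)) = (\<Sum>(x, K)\<in>pN. cmod (h (Sup K) - h (Inf K)))"
        by (rule sum.cong) (auto simp: E_def pN_def k_def norm_minus_commute)
      also have "(\<Sum>z\<in>p - pN. cmod (E z)) \<le> (\<Sum>(x, K)\<in>p - pN. \<epsilon> * measure lborel K)"
      proof (intro sum_mono, clarify)
        fix x K assume xK: "(x, K) \<in> p" "(x, K) \<notin> pN"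
        obtain u v where K: "K = {u..v}" "u \<le> v" "u \<le> x" "x \<le> v" "K \<subseteq> {a..b}" using pI[OF xK(1)] by blast
        show "cmod (E (x, K)) \<le> \<epsilon> * measure lborel K"
        proof (cases "measure lborel K = 0")
          case True
          then show ?thesis using K by (simp add: E_def)
        next
          case False
          then have x: "x \<in> {a..b} - N" using xK K by (auto simp: pN_def)
          have "K \<subseteq> ball x (r x)" using p(2) xK(1) by (auto simp: fine_def)
          then have "u \<in> ball x (r x)" "v \<in> ball x (r x)" using K(1,2) by (auto dest: subsetD)
          then have "\<bar>u - x\<bar> < r x" "\<bar>v - x\<bar> < r x" by (auto simp: dist_real_def)
          moreover have "u \<in> {a..b}" "v \<in> {a..b}" using K by auto
          ultimately have 1: "cmod (h u - h x - (u - x) *\<^sub>R k x) \<le> \<epsilon> * (x - u)" "cmod (h v - h x - (v - x) *\<^sub>R k x) \<le> \<epsilon> * (v - x)"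
            using r(3)[OF x, of u] r(3)[OF x, of v] K(3,4) by simp_all
          \<comment> \<open>Straddle argument: the increment over \<open>K\<close> is split at the
            tag, and the two first order errors are controlled by lengths that add up to that of
            \<open>K\<close>.\<close>
          have "E (x, K) = (h u - h x - (u - x) *\<^sub>R k x) - (h v - h x - (v - x) *\<^sub>R k x)"
            using K by (simp add: E_def scaleR_diff_left algebra_simps)
          also have "cmod \<dots> \<le> \<epsilon> * (x - u) + \<epsilon> * (v - x)"
            by (rule order_trans[OF norm_triangle_ineq4 add_mono[OF 1]])
          also have "\<dots> = \<epsilon> * measure lborel K" using K by (simp add: algebra_simps)
          finally show ?thesis .
        qed
      qed
      also have "\<dots> \<le> (\<Sum>(x, K)\<in>p. \<epsilon> * measure lborel K)"
        using fin \<epsilon> by (intro sum_mono2) auto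
      also have "\<dots> = \<epsilon> * (b - a)"
        using additive_content_tagged_division[of p a b, unfolded cbox_interval, OF p(1)] ab
        by (simp add: case_prod_unfold flip: sum_distrib_left)
      finally show "cmod ((\<Sum>(x, K)\<in>p. measure lborel K *\<^sub>R k x) - (h b - h a)) < e"
        using sumN \<epsilon>_sum by simp
    qed
  qed
  then show ?thesis
    by (rule has_integral_spike[OF N, rotated]) (simp add: k_def)
qed

section \<open>Regularity of absolutely continuous solutions\<close>

lemma abs_cont_on_subinterval:
  assumes "abs_cont_on a b h" "a \<le> c" "d \<le> b"
  shows "abs_cont_on c d h"
  unfolding abs_cont_on_def
proof (intro allI impI)
  fix \<epsilon> :: real assume "0 < \<epsilon>"
  then obtain \<delta> where \<delta>: "0 < \<delta>" and H: "\<And>(n::nat) u v.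
        (\<forall>i<n. a \<le> u i \<and> u i \<le> v i \<and> v i \<le> b) \<Longrightarrow>
        disjoint_family_on (\<lambda>i. {u i<..<v i}) {..<n} \<Longrightarrow>
        (\<Sum>i<n. v i - u i) < \<delta> \<Longrightarrow> (\<Sum>i<n. cmod (h (v i) - h (u i))) < \<epsilon>"
    using assms(1) unfolding abs_cont_on_def by meson
  show "\<exists>\<delta>>0. \<forall>(n::nat) u v.
        (\<forall>i<n. c \<le> u i \<and> u i \<le> v i \<and> v i \<le> d) \<and>
        disjoint_family_on (\<lambda>i. {u i<..<v i}) {..<n} \<and>
        (\<Sum>i<n. v i - u i) < \<delta> \<longrightarrow> (\<Sum>i<n. cmod (h (v i) - h (u i))) < \<epsilon>"
  proof (intro exI[of _ \<delta>] conjI allI impI \<delta>; elim conjE)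
    fix n :: nat and u v
    assume A: "\<forall>i<n. c \<le> u i \<and> u i \<le> v i \<and> v i \<le> d"
      "disjoint_family_on (\<lambda>i. {u i<..<v i}) {..<n}" "(\<Sum>i<n. v i - u i) < \<delta>"
    show "(\<Sum>i<n. cmod (h (v i) - h (u i))) < \<epsilon>"
      by (rule H[OF _ A(2,3)]) (meson A(1) assms(2,3) order_trans)
  qed
qed

lemma abs_cont_on_imp_continuous_on:
  assumes "abs_cont_on a b h"
  shows "continuous_on {a..b} h"
  unfolding continuous_on_iff
proof (intro ballI allI impI)
  fix x \<epsilon> assume x: "x \<in> {a..b}" and "(0::real) < \<epsilon>"
  then obtain \<delta> where \<delta>: "0 < \<delta>" and H: "\<And>(n::nat) u v.
        (\<forall>i<n. a \<le> u i \<and> u i \<le> v i \<and> v i \<le> b) \<Longrightarrow>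
        disjoint_family_on (\<lambda>i. {u i<..<v i}) {..<n} \<Longrightarrow>
        (\<Sum>i<n. v i - u i) < \<delta> \<Longrightarrow> (\<Sum>i<n. cmod (h (v i) - h (u i))) < \<epsilon>"
    using assms(1) unfolding abs_cont_on_def by meson
  have *: "dist (h v) (h u) < \<epsilon>" if "a \<le> u" "u \<le> v" "v \<le> b" "v - u < \<delta>" for u v
    using H[of 1 "\<lambda>_. u" "\<lambda>_. v"] that by (auto simp: disjoint_family_on_def dist_norm)
  have "dist (h y) (h x) < \<epsilon>" if "y \<in> {a..b}" "dist y x < \<delta>" for y
    using *[of x y] *[of y x] x that by (cases "x \<le> y") (auto simp: dist_commute dist_real_def)
  then show "\<exists>d>0. \<forall>y\<in>{a..b}. dist y x < d \<longrightarrow> dist (h y) (h x) < \<epsilon>" using \<delta> by blast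
qed

text \<open>The right hand sides are continuous. An absolutely continuous function whose derivative
  is almost everywhere equal to a continuous function is an integral of that function, hence
  differentiable at every point, the exceptional ones included.\<close>

lemma ac_solution_has_vector_derivative:
  assumes "ac_solution b p q f g" and pq: "continuous_on {0..b} p" "continuous_on {0..b} q"
    and x: "x \<in> {0..b}"
  shows "(f has_vector_derivative q x * f x - p x * g x) (at x within {0..b})"
    and "(g has_vector_derivative - p x * f x - q x * g x) (at x within {0..b})"
proof -
  have ac: "abs_cont_on 0 b f" "abs_cont_on 0 b g"
    and ae: "AE x in lebesgue_on {0..b}. \<exists>f' g'.
        (f has_vector_derivative f') (at x within {0..b}) \<and>
        (g has_vector_derivative g') (at x within {0..b}) \<and>
        g' + p x * f x + q x * g x = 0 \<and> - f' + q x * f x - p x * g x = 0"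
    using assms(1) by (auto simp: ac_solution_def)
  have fg: "continuous_on {0..b} f" "continuous_on {0..b} g"
    using ac abs_cont_on_imp_continuous_on by auto
  define N where "N = {x. \<not> (x \<in> {0..b} \<longrightarrow> (f has_vector_derivative q x * f x - p x * g x) (at x within {0..b}) \<and>
       (g has_vector_derivative - p x * f x - q x * g x) (at x within {0..b}))}"
  have "AE x in lebesgue. x \<in> {0..b} \<longrightarrow> (f has_vector_derivative q x * f x - p x * g x) (at x within {0..b}) \<and>
       (g has_vector_derivative - p x * f x - q x * g x) (at x within {0..b})"
    using ae unfolding AE_restrict_space_iff[of "{0..b}" lebesgue, simplified]
  proof eventually_elim
    case (elim x)
    show ?case
    proof
      assume x: "x \<in> {0..b}"
      obtain f' g' where d: "(f has_vector_derivative f') (at x within {0..b})"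
        "(g has_vector_derivative g') (at x within {0..b})"
        and e: "g' + p x * f x + q x * g x = 0" "- f' + q x * f x - p x * g x = 0"
        using mp[OF elim x[unfolded atLeastAtMost_iff]] by (elim exE conjE) (rule that)
      have "f' = (q x * f x - p x * g x) - (- f' + q x * f x - p x * g x)"
        "g' = (- p x * f x - q x * g x) + (g' + p x * f x + q x * g x)" by simp_all
      then have "f' = q x * f x - p x * g x" "g' = - p x * f x - q x * g x" unfolding e by simp_all
      then show "(f has_vector_derivative q x * f x - p x * g x) (at x within {0..b}) \<and>
        (g has_vector_derivative - p x * f x - q x * g x) (at x within {0..b})" using d by simp
    qed
  qed
  then have N: "negligible N" unfolding eventually_ae_filter_negligible N_def by (auto intro: negligible_subset)
  have C1: "(h has_vector_derivative h' x) (at x within {0..b})"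
    if h: "abs_cont_on 0 b h" and h': "continuous_on {0..b} h'"
      and d: "\<And>x. x \<in> {0..b} - N \<Longrightarrow> (h has_vector_derivative h' x) (at x within {0..b})" for h h'
  proof -
    have "h y = h 0 + integral {0..y} h'" if y: "y \<in> {0..b}" for y
    proof -
      have "(h' has_integral h y - h 0) {0..y}"
        using y by (intro abs_cont_on_fundamental_theorem[OF abs_cont_on_subinterval[OF h] N]
            has_vector_derivative_within_subset[OF d]) auto
      then show ?thesis by (simp add: integral_unique)
    qed
    moreover have "((\<lambda>y. h 0 + integral {0..y} h') has_vector_derivative 0 + h' x) (at x within {0..b})"
      by (intro has_vector_derivative_add has_vector_derivative_const integral_has_vector_derivative h' x)
    ultimately have "(h has_vector_derivative 0 + h' x) (at x within {0..b})"
      by (rule has_vector_derivative_transform[OF x])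
    then show ?thesis by simp
  qed
  show "(f has_vector_derivative q x * f x - p x * g x) (at x within {0..b})"
    by (rule C1[OF ac(1)]) (intro continuous_intros fg pq, auto simp: N_def)
  show "(g has_vector_derivative - p x * f x - q x * g x) (at x within {0..b})"
    by (rule C1[OF ac(2)]) (intro continuous_intros fg pq, auto simp: N_def)
qed

section \<open>Formal powers\<close>

text \<open>\<open>B V' + Q V = W\<close>, solved for \<open>V'\<close> by means of \<open>B\<^sup>2 = -1\<close>.\<close>

definition dirac_image_on ::
    "real \<Rightarrow> (real \<Rightarrow> complex) \<Rightarrow> (real \<Rightarrow> complex) \<Rightarrow> (real \<Rightarrow> complex^2) \<Rightarrow> (real \<Rightarrow> complex^2) \<Rightarrow> bool" where
  "dirac_image_on b p q V W \<longleftrightarrow> (\<forall>x\<in>{0..b}.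
     (V has_vector_derivative potential p q x *v V x - matB *v W x) (at x within {0..b}))"

text \<open>The signs come from the rows \<open>(q, - p)\<close> and \<open>(- p, - q)\<close> of
  the potential and from \<open>B (w1, w2) = (w2, - w1)\<close>.\<close>

lemma dirac_image_on_pair:
  assumes "\<And>x. x \<in> {0..b} \<Longrightarrow> (u has_vector_derivative q x * u x - p x * v x - w2 x) (at x within {0..b})"
    "\<And>x. x \<in> {0..b} \<Longrightarrow> (v has_vector_derivative - p x * u x - q x * v x + w1 x) (at x within {0..b})"
  shows "dirac_image_on b p q (\<lambda>x. vector [u x, v x]) (\<lambda>x. vector [w1 x, w2 x])"
proof -
  have l1: "bounded_linear (\<lambda>z::complex. vector [z, 0] :: complex^2)"
    and l2: "bounded_linear (\<lambda>z::complex. vector [0, z] :: complex^2)"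
    by (auto intro!: linearI simp: vec_eq_iff forall_2 simp flip: linear_conv_bounded_linear)
  have split: "vector [a, c] = vector [a, 0] + (vector [0, c] :: complex^2)" for a c :: complex
    by (simp add: vec_eq_iff forall_2)
  show ?thesis
    unfolding dirac_image_on_def
  proof
    fix x assume x: "x \<in> {0..b}"
    have "((\<lambda>x. vector [u x, 0] + (vector [0, v x] :: complex^2)) has_vector_derivative
        vector [q x * u x - p x * v x - w2 x, 0] + vector [0, - p x * u x - q x * v x + w1 x]) (at x within {0..b})"
      by (intro has_vector_derivative_add bounded_linear.has_vector_derivative[OF l1]
          bounded_linear.has_vector_derivative[OF l2] assms x)
    moreover have "vector [q x * u x - p x * v x - w2 x, 0] + vector [0, - p x * u x - q x * v x + w1 x]
        = potential p q x *v vector [u x, v x] - matB *v vector [w1 x, w2 x]"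
      by (simp add: matB_def matQ_def mat2_simps matrix_vector_mult_def)
    ultimately show "((\<lambda>x. vector [u x, v x]) has_vector_derivative
        potential p q x *v vector [u x, v x] - matB *v vector [w1 x, w2 x]) (at x within {0..b})"
      by (simp only: split[symmetric])
  qed
qed

lemma dirac_image_on_scale:
  assumes "dirac_image_on b p q V W" and eq: "\<And>x. V' x = c *s V x" "\<And>x. W' x = c *s W x"
  shows "dirac_image_on b p q V' W'"
proof -
  have "bounded_linear (\<lambda>v::complex^2. c *s v)"
    by (auto intro!: linearI simp: vec_eq_iff algebra_simps simp flip: linear_conv_bounded_linear)
  from bounded_linear.has_vector_derivative[OF this] assms(1)
  have "((\<lambda>x. c *s V x) has_vector_derivative c *s (potential p q x *v V x - matB *v W x)) (at x within {0..b})"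
    if "x \<in> {0..b}" for x using that unfolding dirac_image_on_def by blast
  moreover have "c *s (potential p q x *v V x - matB *v W x) = potential p q x *v (c *s V x) - matB *v (c *s W x)" for x
    by (simp add: vec_eq_iff matrix_vector_mult_def sum_2 algebra_simps)
  ultimately show ?thesis unfolding dirac_image_on_def eq by simp
qed

text \<open>Here the equations hold at every point: \<open>(f, g)\<close> is a continuously
  differentiable solution of \<open>B V' + Q V = 0\<close>, the form to which an
  \<open>ac_solution\<close> is reduced.\<close>

locale nonvanishing_solution =
  fixes b :: real and p q f g :: "real \<Rightarrow> complex"
  assumes b: "b > 0"
    and pq: "continuous_on {0..b} p" "continuous_on {0..b} q"
    and f_der: "\<And>x. x \<in> {0..b} \<Longrightarrow> (f has_vector_derivative q x * f x - p x * g x) (at x within {0..b})"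
    and g_der: "\<And>x. x \<in> {0..b} \<Longrightarrow> (g has_vector_derivative - p x * f x - q x * g x) (at x within {0..b})"
    and nz: "\<And>x. x \<in> {0..b} \<Longrightarrow> f x \<noteq> 0" "\<And>x. x \<in> {0..b} \<Longrightarrow> g x \<noteq> 0"
    and fg0: "f 0 * g 0 = 1"
begin

lemma cont_fg: "continuous_on {0..b} f" "continuous_on {0..b} g"
  by (rule continuous_on_vector_derivative, erule f_der g_der)+

text \<open>The difference of the two components is known in closed form, which turns the recurrences into
  first order differential equations.\<close>

lemma cofactor_difference:
  assumes Z: "\<And>x. x \<in> {0..b} \<Longrightarrow> (Z has_vector_derivative z x) (at x within {0..b})"
    and X: "\<And>x. x \<in> {0..b} \<Longrightarrow> (X has_vector_derivative c * (p x / (f x)\<^sup>2 * Z x + a x)) (at x within {0..b})"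
    and Y: "\<And>x. x \<in> {0..b} \<Longrightarrow> (Y has_vector_derivative - c * (p x / (g x)\<^sup>2 * Z x + d x)) (at x within {0..b})"
    and z: "\<And>x. x \<in> {0..b} \<Longrightarrow> z x = f x * g x * (a x + d x)"
    and init: "X 0 - Y 0 = c * Z 0" and x: "x \<in> {0..b}"
  shows "X x - Y x = c * Z x / (f x * g x)"
proof -
  \<comment> \<open>Since \<open>(f g)' = - p (f\<^sup>2 + g\<^sup>2)\<close>, differentiating
    \<open>1 / (f g)\<close> produces exactly the \<open>p\<close>-terms of the derivative of
    \<open>X - Y\<close>, and \<open>z = f g (a + d)\<close> accounts for the rest. So
    \<open>E\<close> is constant; it vanishes at 0 by \<open>init\<close> and
    \<open>f 0 * g 0 = 1\<close>.\<close>
  define E where "E = (\<lambda>x. (X x - Y x) - c * Z x * inverse (f x * g x))"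
  have "(E has_vector_derivative 0) (at x within {0..b})" if x: "x \<in> {0..b}" for x
  proof -
    have fg: "((\<lambda>x. f x * g x) has_vector_derivative - p x * ((f x)\<^sup>2 + (g x)\<^sup>2)) (at x within {0..b})"
      using has_vector_derivative_mult[OF f_der[OF x] g_der[OF x]]
      by (simp add: algebra_simps power2_eq_square)
    have inv: "((\<lambda>x. inverse (f x * g x)) has_vector_derivative
        - p x * ((f x)\<^sup>2 + (g x)\<^sup>2) * - (inverse (f x * g x) * inverse (f x * g x))) (at x within {0..b})"
    proof -
      have "f x * g x \<noteq> 0" using nz[OF x] by simp
      then have "(inverse has_field_derivative - (inverse (f x * g x) * inverse (f x * g x)))
          (at (f x * g x) within (\<lambda>x. f x * g x) ` {0..b})"
        by (auto intro!: derivative_eq_intros)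
      from field_vector_diff_chain_within[OF fg this] show ?thesis by (simp add: o_def)
    qed
    have "(E has_vector_derivative
        (c * (p x / (f x)\<^sup>2 * Z x + a x) - - c * (p x / (g x)\<^sup>2 * Z x + d x))
        - ((c * Z x) * (- p x * ((f x)\<^sup>2 + (g x)\<^sup>2) * - (inverse (f x * g x) * inverse (f x * g x))) + c * z x * inverse (f x * g x))) (at x within {0..b})"
      unfolding E_def
      by (intro has_vector_derivative_diff has_vector_derivative_mult has_vector_derivative_mult_right X Y Z inv x)
    moreover have "(c * (p x / (f x)\<^sup>2 * Z x + a x) - - c * (p x / (g x)\<^sup>2 * Z x + d x))
        - ((c * Z x) * (- p x * ((f x)\<^sup>2 + (g x)\<^sup>2) * - (inverse (f x * g x) * inverse (f x * g x))) + c * z x * inverse (f x * g x)) = 0"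
      using nz[OF x] unfolding z[OF x] by (simp add: field_simps power2_eq_square)
    ultimately show ?thesis by simp
  qed
  then obtain e where "\<And>x. x \<in> {0..b} \<Longrightarrow> E x = e"
    using has_vector_derivative_zero_constant[of "{0..b}" E] by auto
  then have "E x = E 0" using x b by simp
  also have "E 0 = 0" unfolding E_def fg0 using init by simp
  finally show ?thesis by (simp add: E_def divide_inverse)
qed

text \<open>\<open>cofactor_difference\<close> with \<open>Z = 1\<close> gives
  \<open>X - Y = s / (f g)\<close>, which turns \<open>- p g X + s p / f\<close> into the coupling
  term \<open>- p g Y\<close>. The two families of formal powers start with \<open>s = -1\<close>
  and, for the tilde family, \<open>s = 1\<close>.\<close>

lemma zero_order_dirac:
  assumes X: "\<And>x. x \<in> {0..b} \<Longrightarrow> (X has_vector_derivative s * (p x / (f x)\<^sup>2)) (at x within {0..b})"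
    and Y: "\<And>x. x \<in> {0..b} \<Longrightarrow> (Y has_vector_derivative - s * (p x / (g x)\<^sup>2)) (at x within {0..b})"
    and init: "X 0 - Y 0 = s"
  shows "dirac_image_on b p q (\<lambda>x. vector [f x * X x, g x * Y x]) (\<lambda>x. 0)"
proof -
  have diff: "X x - Y x = s * 1 / (f x * g x)" if "x \<in> {0..b}" for x
    by (rule cofactor_difference[where Z = "\<lambda>_. 1" and z = "\<lambda>_. 0" and a = "\<lambda>_. 0" and d = "\<lambda>_. 0"])
      (use X Y init that in auto)
  have "dirac_image_on b p q (\<lambda>x. vector [f x * X x, g x * Y x]) (\<lambda>x. vector [0, 0])"
  proof (rule dirac_image_on_pair)
    fix x assume x: "x \<in> {0..b}"
    have Xx: "X x = Y x + s * 1 / (f x * g x)" using diff[OF x] by algebra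
    show "((\<lambda>x. f x * X x) has_vector_derivative q x * (f x * X x) - p x * (g x * Y x) - 0) (at x within {0..b})"
      by (rule has_vector_derivative_eq_rhs[OF has_vector_derivative_mult[OF f_der[OF x] X[OF x]]])
        (use nz[OF x] in \<open>simp add: Xx field_simps power2_eq_square\<close>)
    show "((\<lambda>x. g x * Y x) has_vector_derivative - p x * (f x * X x) - q x * (g x * Y x) + 0) (at x within {0..b})"
      by (rule has_vector_derivative_eq_rhs[OF has_vector_derivative_mult[OF g_der[OF x] Y[OF x]]])
        (use nz[OF x] in \<open>simp add: Xx field_simps power2_eq_square\<close>)
  qed
  moreover have "(\<lambda>x. vector [0, 0]) = (\<lambda>x::real. 0 :: complex^2)" by (simp add: fun_eq_iff vec_eq_iff forall_2)
  ultimately show ?thesis by simp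
qed

text \<open>Primes mark the pair of the next order, not derivatives.
  \<open>cofactor_difference\<close> applies with \<open>a = g / f * Y\<close> and
  \<open>d = f / g * X\<close>, because \<open>Z\<close> has the derivative
  \<open>f g (a + d)\<close>; the difference \<open>- c * Z / (f g)\<close> then absorbs the
  \<open>Z\<close>-terms of the recurrence.\<close>

lemma recurrence_dirac:
  fixes X Y c defines "Z \<equiv> formal_Z f g X Y"
  assumes X: "continuous_on {0..b} X" and Y: "continuous_on {0..b} Y"
  defines "X' \<equiv> \<lambda>x. - c * integral {0..x} (\<lambda>s. p s / (f s)\<^sup>2 * Z s + g s / f s * Y s)"
    and "Y' \<equiv> \<lambda>x. c * integral {0..x} (\<lambda>s. p s / (g s)\<^sup>2 * Z s + f s / g s * X s)"
  shows "dirac_image_on b p q (\<lambda>x. vector [f x * X' x, g x * Y' x]) (\<lambda>x. c *s vector [f x * X x, g x * Y x])"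
    and "continuous_on {0..b} X'" "continuous_on {0..b} Y'"
proof -
  have cZ': "continuous_on {0..b} (\<lambda>s. (f s)\<^sup>2 * X s + (g s)\<^sup>2 * Y s)"
    by (intro continuous_intros cont_fg X Y)
  have Z: "(Z has_vector_derivative (f x)\<^sup>2 * X x + (g x)\<^sup>2 * Y x) (at x within {0..b})" if "x \<in> {0..b}" for x
    unfolding Z_def formal_Z_def by (rule integral_has_vector_derivative[OF cZ' that])
  then have cZ: "continuous_on {0..b} Z" by (rule continuous_on_vector_derivative)
  have dX: "(X' has_vector_derivative - c * (p x / (f x)\<^sup>2 * Z x + g x / f x * Y x)) (at x within {0..b})" if "x \<in> {0..b}" for x
    unfolding X'_def
    by (intro has_vector_derivative_mult_right integral_has_vector_derivative that continuous_intros pq cont_fg cZ Y)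
      (use nz in auto)
  have dY: "(Y' has_vector_derivative c * (p x / (g x)\<^sup>2 * Z x + f x / g x * X x)) (at x within {0..b})" if "x \<in> {0..b}" for x
    unfolding Y'_def
    by (intro has_vector_derivative_mult_right integral_has_vector_derivative that continuous_intros pq cont_fg cZ X)
      (use nz in auto)
  show "continuous_on {0..b} X'" "continuous_on {0..b} Y'"
    by (rule continuous_on_vector_derivative, erule dX dY)+
  have diff: "X' x - Y' x = - c * Z x / (f x * g x)" if "x \<in> {0..b}" for x
  proof (rule cofactor_difference[OF Z dX _ _ _ that])
    fix x assume x: "x \<in> {0..b}"
    show "(Y' has_vector_derivative - (- c) * (p x / (g x)\<^sup>2 * Z x + f x / g x * X x)) (at x within {0..b})"
      using dY[OF x] by simp
    show "(f x)\<^sup>2 * X x + (g x)\<^sup>2 * Y x = f x * g x * (g x / f x * Y x + f x / g x * X x)"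
      using nz[OF x] by (simp add: field_simps power2_eq_square)
  qed (simp_all add: X'_def Y'_def Z_def formal_Z_def)
  have "dirac_image_on b p q (\<lambda>x. vector [f x * X' x, g x * Y' x]) (\<lambda>x. vector [c * (f x * X x), c * (g x * Y x)])"
  proof (rule dirac_image_on_pair)
    fix x assume x: "x \<in> {0..b}"
    have "X' x = Y' x + (X' x - Y' x)" by simp
    then have Xx: "X' x = Y' x - c * Z x / (f x * g x)" unfolding diff[OF x] by simp
    show "((\<lambda>x. f x * X' x) has_vector_derivative q x * (f x * X' x) - p x * (g x * Y' x) - c * (g x * Y x)) (at x within {0..b})"
      by (rule has_vector_derivative_eq_rhs[OF has_vector_derivative_mult[OF f_der[OF x] dX[OF x]]])
        (use nz[OF x] in \<open>simp add: Xx field_simps power2_eq_square\<close>)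
    show "((\<lambda>x. g x * Y' x) has_vector_derivative - p x * (f x * X' x) - q x * (g x * Y' x) + c * (f x * X x)) (at x within {0..b})"
      by (rule has_vector_derivative_eq_rhs[OF has_vector_derivative_mult[OF g_der[OF x] dY[OF x]]])
        (use nz[OF x] in \<open>simp add: Xx field_simps power2_eq_square\<close>)
  qed
  moreover have "vector [c * (f x * X x), c * (g x * Y x)] = (c *s vector [f x * X x, g x * Y x] :: complex^2)" for x
    by (simp add: vec_eq_iff forall_2)
  ultimately show "dirac_image_on b p q (\<lambda>x. vector [f x * X' x, g x * Y' x]) (\<lambda>x. c *s vector [f x * X x, g x * Y x])"
    by simp
qed

lemma formal_XY_Suc_dirac:
  assumes "continuous_on {0..b} (fst XY0)" "continuous_on {0..b} (snd XY0)"
  shows "continuous_on {0..b} (fst (formal_XY p f g XY0 n))" "continuous_on {0..b} (snd (formal_XY p f g XY0 n))"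
    and "dirac_image_on b p q
      (\<lambda>x. vector [f x * fst (formal_XY p f g XY0 (Suc n)) x, g x * snd (formal_XY p f g XY0 (Suc n)) x])
      (\<lambda>x. of_nat (Suc n) *s vector [f x * fst (formal_XY p f g XY0 n) x, g x * snd (formal_XY p f g XY0 n) x])"
proof -
  have *: "continuous_on {0..b} (fst (formal_XY p f g XY0 n)) \<and> continuous_on {0..b} (snd (formal_XY p f g XY0 n))" for n
  proof (induction n)
    case (Suc n)
    then show ?case
      using recurrence_dirac(2,3)[of "fst (formal_XY p f g XY0 n)" "snd (formal_XY p f g XY0 n)" "of_nat (n + 1)"]
      by (simp add: Let_def)
  qed (use assms in simp)
  then show c: "continuous_on {0..b} (fst (formal_XY p f g XY0 n))" "continuous_on {0..b} (snd (formal_XY p f g XY0 n))"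
    by auto
  show "dirac_image_on b p q
      (\<lambda>x. vector [f x * fst (formal_XY p f g XY0 (Suc n)) x, g x * snd (formal_XY p f g XY0 (Suc n)) x])
      (\<lambda>x. of_nat (Suc n) *s vector [f x * fst (formal_XY p f g XY0 n) x, g x * snd (formal_XY p f g XY0 n) x])"
    using recurrence_dirac(1)[OF c, of "of_nat (n + 1)"] by (simp add: Let_def)
qed

lemma integral_p_div:
  assumes "h = f \<or> h = g" "x \<in> {0..b}"
  shows "((\<lambda>x. integral {0..x} (\<lambda>s. p s / (h s)\<^sup>2)) has_vector_derivative p x / (h x)\<^sup>2) (at x within {0..b})"
  by (rule integral_has_vector_derivative[OF _ assms(2)])
    (use assms nz in \<open>auto intro!: continuous_intros pq cont_fg\<close>)

lemma fgXY_dirac: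
  "dirac_image_on b p q (fgXY p f g 0) (\<lambda>x. 0)"
  "dirac_image_on b p q (fgXY p f g (Suc n)) (\<lambda>x. of_nat (Suc n) *s fgXY p f g n x)"
  "dirac_image_on b p q (fgXY_tilde p f g 0) (\<lambda>x. 0)"
  "dirac_image_on b p q (fgXY_tilde p f g (Suc n)) (\<lambda>x. of_nat (Suc n) *s fgXY_tilde p f g n x)"
proof -
  note ders = has_vector_derivative_minus[OF integral_p_div]
    has_vector_derivative_add[OF has_vector_derivative_const integral_p_div]
  have F: "((\<lambda>x. - integral {0..x} (\<lambda>s. p s / (f s)\<^sup>2)) has_vector_derivative - 1 * (p x / (f x)\<^sup>2)) (at x within {0..b})"
    "((\<lambda>x. - integral {0..x} (\<lambda>s. p s / (g s)\<^sup>2)) has_vector_derivative - 1 * (p x / (g x)\<^sup>2)) (at x within {0..b})"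
    "((\<lambda>x. 1 + integral {0..x} (\<lambda>s. p s / (f s)\<^sup>2)) has_vector_derivative 1 * (p x / (f x)\<^sup>2)) (at x within {0..b})"
    "((\<lambda>x. 1 + integral {0..x} (\<lambda>s. p s / (g s)\<^sup>2)) has_vector_derivative - (- 1) * (p x / (g x)\<^sup>2)) (at x within {0..b})"
    if "x \<in> {0..b}" for x
    using ders[of f x] ders[of g x] that by simp_all
  have cont: "continuous_on {0..b} (\<lambda>x. - integral {0..x} (\<lambda>s. p s / (f s)\<^sup>2))"
    "continuous_on {0..b} (\<lambda>x. - integral {0..x} (\<lambda>s. p s / (g s)\<^sup>2))"
    "continuous_on {0..b} (\<lambda>x. 1 + integral {0..x} (\<lambda>s. p s / (f s)\<^sup>2))"
    "continuous_on {0..b} (\<lambda>x. 1 + integral {0..x} (\<lambda>s. p s / (g s)\<^sup>2))"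
    by (rule continuous_on_vector_derivative, erule F)+
  show "dirac_image_on b p q (fgXY p f g 0) (\<lambda>x. 0)"
    unfolding fgXY_def powXY_def formal_XY.simps fst_conv snd_conv
    by (rule zero_order_dirac[OF F(1) F(4)]) auto
  show "dirac_image_on b p q (fgXY_tilde p f g 0) (\<lambda>x. 0)"
    unfolding fgXY_tilde_def powXY_tilde_def formal_XY.simps fst_conv snd_conv
    by (rule zero_order_dirac[OF F(3) F(2)]) auto
  show "dirac_image_on b p q (fgXY p f g (Suc n)) (\<lambda>x. of_nat (Suc n) *s fgXY p f g n x)"
    unfolding fgXY_def powXY_def by (rule formal_XY_Suc_dirac(3)) (simp_all only: fst_conv snd_conv cont)
  show "dirac_image_on b p q (fgXY_tilde p f g (Suc n)) (\<lambda>x. of_nat (Suc n) *s fgXY_tilde p f g n x)"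
    unfolding fgXY_tilde_def powXY_tilde_def by (rule formal_XY_Suc_dirac(3)) (simp_all only: fst_conv snd_conv cont)
qed

text \<open>\<open>Phi\<close> and \<open>Psi\<close> switch between \<open>fgXY\<close> and
  \<open>fgXY_tilde\<close> with the parity of the order. Lowering the order within one family
  therefore exchanges them, and the powers of -1 are arranged so that the sign is always minus from
  \<open>Phi\<close> to \<open>Psi\<close> and plus back. For \<open>n = 0\<close> the factor
  \<open>real n\<close> neutralizes the truncated \<open>n - 1\<close>.\<close>

lemma Phi_dirac: "dirac_image_on b p q (Phi p f g n) (\<lambda>x. - real n *\<^sub>R Psi p f g (n - 1) x)"
  and Psi_dirac: "dirac_image_on b p q (Psi p f g n) (\<lambda>x. real n *\<^sub>R Phi p f g (n - 1) x)"
proof -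
  note vec = vec_eq_iff vector_smult_component vector_scaleR_component vector_uminus_component
    scaleR_conv_of_real[where 'a = complex]
  have "dirac_image_on b p q (Phi p f g n) (\<lambda>x. - real n *\<^sub>R Psi p f g (n - 1) x) \<and>
    dirac_image_on b p q (Psi p f g n) (\<lambda>x. real n *\<^sub>R Phi p f g (n - 1) x)"
  proof (cases n)
    case 0
    then show ?thesis
      using dirac_image_on_scale[OF fgXY_dirac(3), of "Phi p f g 0" "g 0" "\<lambda>_. 0"]
        dirac_image_on_scale[OF fgXY_dirac(1), of "Psi p f g 0" "f 0" "\<lambda>_. 0"]
      by (simp add: Phi_def Psi_def)
  next
    case (Suc k)
    show ?thesis
    proof (cases "even k")
      case True
      then obtain j where j: "k = 2 * j" by (elim evenE)
      have "dirac_image_on b p q (Phi p f g n) (\<lambda>x. - real n *\<^sub>R Psi p f g (n - 1) x)"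
        by (rule dirac_image_on_scale[OF fgXY_dirac(2)[of k], where c = "(-1) ^ (j + 1) * f 0"];
            simp only: vec Suc Phi_def Psi_def) (simp_all add: j algebra_simps)
      moreover have "dirac_image_on b p q (Psi p f g n) (\<lambda>x. real n *\<^sub>R Phi p f g (n - 1) x)"
        by (rule dirac_image_on_scale[OF fgXY_dirac(4)[of k], where c = "(-1) ^ j * g 0"];
            simp only: vec Suc Phi_def Psi_def) (simp_all add: j algebra_simps)
      ultimately show ?thesis ..
    next
      case False
      then obtain j where j: "k = 2 * j + 1" by (elim oddE)
      have "dirac_image_on b p q (Phi p f g n) (\<lambda>x. - real n *\<^sub>R Psi p f g (n - 1) x)"
        by (rule dirac_image_on_scale[OF fgXY_dirac(4)[of k], where c = "(-1) ^ (j + 1) * g 0"];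
            simp only: vec Suc Phi_def Psi_def) (simp_all add: j algebra_simps)
      moreover have "dirac_image_on b p q (Psi p f g n) (\<lambda>x. real n *\<^sub>R Phi p f g (n - 1) x)"
        by (rule dirac_image_on_scale[OF fgXY_dirac(2)[of k], where c = "(-1) ^ (j + 1) * f 0"];
            simp only: vec Suc Phi_def Psi_def) (simp_all add: j algebra_simps)
      ultimately show ?thesis ..
    qed
  qed
  then show "dirac_image_on b p q (Phi p f g n) (\<lambda>x. - real n *\<^sub>R Psi p f g (n - 1) x)"
    "dirac_image_on b p q (Psi p f g n) (\<lambda>x. real n *\<^sub>R Phi p f g (n - 1) x)" by auto
qed

text \<open>Positive orders are integrals starting at 0; in order zero the factors
  \<open>g 0\<close> and \<open>f 0\<close> normalize the vectors by
  \<open>f 0 * g 0 = 1\<close>.\<close>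

lemma Phi_at_0: "Phi p f g n 0 = (if n = 0 then vector [1, 0] else 0)"
  and Psi_at_0: "Psi p f g n 0 = (if n = 0 then vector [0, 1] else 0)"
proof -
  have "fst (formal_XY p f g XY0 (Suc n)) 0 = 0" "snd (formal_XY p f g XY0 (Suc n)) 0 = 0" for XY0 n
    by (simp_all add: Let_def)
  then show "Phi p f g n 0 = (if n = 0 then vector [1, 0] else 0)"
    "Psi p f g n 0 = (if n = 0 then vector [0, 1] else 0)"
    using fg0 by (cases n; simp add: Phi_def Psi_def fgXY_def fgXY_tilde_def powXY_def powXY_tilde_def
        vec_eq_iff forall_2 mult.commute del: formal_XY.simps(2))+
qed

end

section \<open>Wave matrices\<close>

lemma matB_mult: "matB ** (matB ** X) = - X" for X :: "complex^2^2"
  by (simp add: matB_def mat2_simps)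

lemma matB_potential: "matB ** (potential p q x ** X) = - (matQ p q x ** X)"
  by (simp add: matB_def matQ_def mat2_simps)

lemma bounded_linear_columns2: "bounded_linear (\<lambda>v. columns2 v 0)" "bounded_linear (\<lambda>v. columns2 0 v)"
  by (auto intro!: linearI simp: columns2_def transpose_def vec_eq_iff forall_2 simp flip: linear_conv_bounded_linear)

lemma columns2_split: "columns2 u v = columns2 u 0 + columns2 0 v"
  by (simp add: columns2_def transpose_def vec_eq_iff forall_2)

definition matrix_dirac_image_on ::
    "real \<Rightarrow> (real \<Rightarrow> complex) \<Rightarrow> (real \<Rightarrow> complex) \<Rightarrow> (real \<Rightarrow> complex^2^2) \<Rightarrow> (real \<Rightarrow> complex^2^2) \<Rightarrow> bool" where
  "matrix_dirac_image_on b p q F G \<longleftrightarrow> (\<forall>x\<in>{0..b}.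
     (F has_vector_derivative potential p q x ** F x - matB ** G x) (at x within {0..b}))"

lemma matrix_dirac_image_on_columns2:
  assumes "dirac_image_on b p q V W" "dirac_image_on b p q V' W'"
  shows "matrix_dirac_image_on b p q (\<lambda>x. columns2 (V x) (V' x)) (\<lambda>x. columns2 (W x) (W' x))"
  unfolding matrix_dirac_image_on_def
proof
  fix x assume x: "x \<in> {0..b}"
  have mv: "columns2 (A *v u) (A *v v) = A ** columns2 u v" for A u v
    by (simp add: columns2_def transpose_def matrix_vector_mult_def mat2_simps)
  have md: "columns2 (u - u') (v - v') = columns2 u v - columns2 u' v'" for u v u' v'
    by (simp add: columns2_def transpose_def vec_eq_iff forall_2)
  have "((\<lambda>x. columns2 (V x) 0 + columns2 0 (V' x)) has_vector_derivative
      columns2 (potential p q x *v V x - matB *v W x) 0 + columns2 0 (potential p q x *v V' x - matB *v W' x)) (at x within {0..b})"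
    using assms x unfolding dirac_image_on_def
    by (intro has_vector_derivative_add bounded_linear.has_vector_derivative[OF bounded_linear_columns2(1)]
        bounded_linear.has_vector_derivative[OF bounded_linear_columns2(2)]) blast+
  then show "((\<lambda>x. columns2 (V x) (V' x)) has_vector_derivative
      potential p q x ** columns2 (V x) (V' x) - matB ** columns2 (W x) (W' x)) (at x within {0..b})"
    by (simp only: columns2_split[symmetric] md mv)
qed

text \<open>\<open>classical_solution\<close> on an arbitrary domain: the wave matrices have to be
  solutions beyond the triangle too, on the strip \<open>{0..b} \<times> UNIV\<close> with the line
  \<open>x = 0\<close> as its edge.\<close>

definition solves_on ::
    "(real \<times> real) set \<Rightarrow> (real \<Rightarrow> complex) \<Rightarrow> (real \<Rightarrow> complex) \<Rightarrow> (real \<times> real \<Rightarrow> complex^2^2) \<Rightarrow> bool" where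
  "solves_on S p q K \<longleftrightarrow>
     (\<exists>Kx Kt. continuous_on S Kx \<and> continuous_on S Kt \<and>
        (\<forall>(x, t)\<in>S.
           (K has_derivative (\<lambda>(h, k). h *\<^sub>R Kx (x, t) + k *\<^sub>R Kt (x, t))) (at (x, t) within S) \<and>
           matB ** Kx (x, t) + Kt (x, t) ** matB = - (matQ p q x ** K (x, t))))"

lemma classical_solution_iff: "classical_solution b p q K \<longleftrightarrow> solves_on (OmegaPlus b) p q K"
  by (simp add: classical_solution_def solves_on_def)

lemma solves_on_subset:
  assumes "solves_on S p q K" "T \<subseteq> S"
  shows "solves_on T p q K"
proof -
  obtain Kx Kt where K: "continuous_on S Kx" "continuous_on S Kt"
    "\<forall>(x, t)\<in>S. (K has_derivative (\<lambda>(h, k). h *\<^sub>R Kx (x, t) + k *\<^sub>R Kt (x, t))) (at (x, t) within S) \<and>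
       matB ** Kx (x, t) + Kt (x, t) ** matB = - (matQ p q x ** K (x, t))"
    using assms(1) unfolding solves_on_def by (elim exE conjE) (rule that)
  show ?thesis
    unfolding solves_on_def
  proof (rule exI[of _ Kx], rule exI[of _ Kt], intro conjI ballI)
    fix z assume "z \<in> T"
    then show "case z of (x, t) \<Rightarrow>
        (K has_derivative (\<lambda>(h, k). h *\<^sub>R Kx (x, t) + k *\<^sub>R Kt (x, t))) (at (x, t) within T) \<and>
        matB ** Kx (x, t) + Kt (x, t) ** matB = - (matQ p q x ** K (x, t))"
      using bspec[OF K(3), of z] assms(2) by (auto intro: has_derivative_subset)
  qed (use K(1,2) assms(2) in \<open>auto intro: continuous_on_subset\<close>)
qed

text \<open>Multiplying the equation by \<open>matB\<close> from the left and projecting isolates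
  \<open>Pminus (Kx + Kt)\<close> and \<open>Pplus (Kx - Kt)\<close>, where \<open>Kx + Kt\<close>
  and \<open>Kx - Kt\<close> are the derivatives in the directions \<xi> and \<eta>.\<close>

lemma solves_on_imp_char_solution:
  assumes "solves_on S p q K" and T: "\<And>\<xi> \<eta>. (\<xi>, \<eta>) \<in> T \<Longrightarrow> (\<xi> + \<eta>, \<xi> - \<eta>) \<in> S"
  shows "char_solution T (potential p q) (\<lambda>(\<xi>, \<eta>). K (\<xi> + \<eta>, \<xi> - \<eta>))"
proof -
  obtain Kx Kt where K: "\<And>x t. (x, t) \<in> S \<Longrightarrow>
      (K has_derivative (\<lambda>(h, k). h *\<^sub>R Kx (x, t) + k *\<^sub>R Kt (x, t))) (at (x, t) within S)"
    "\<And>x t. (x, t) \<in> S \<Longrightarrow> matB ** Kx (x, t) + Kt (x, t) ** matB = - (matQ p q x ** K (x, t))"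
    using assms(1) unfolding solves_on_def by fast
  have "continuous_on S K"
    by (rule has_derivative_continuous_on[where f' = "\<lambda>z (h, k). h *\<^sub>R Kx z + k *\<^sub>R Kt z"]) (use K(1) in auto)
  then have "continuous_on T (\<lambda>z. K (fst z + snd z, fst z - snd z))"
    by (rule continuous_on_compose2) (use T in \<open>auto intro!: continuous_intros\<close>)
  then have cont: "continuous_on T (\<lambda>(\<xi>, \<eta>). K (\<xi> + \<eta>, \<xi> - \<eta>))"
    by (simp add: case_prod_unfold)
  have alg: "Pminus (Kx (x, t) + Kt (x, t)) = potential p q x ** Pplus (K (x, t))"
    "Pplus (Kx (x, t) - Kt (x, t)) = potential p q x ** Pminus (K (x, t))" if "(x, t) \<in> S" for x t
  proof -
    \<comment> \<open>\<open>matB ** (matB ** X + Y ** matB)\<close> equals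
      \<open>- X + matB ** Y ** matB\<close>, and the conjugation of \<open>Y\<close> acts as -1
      under \<open>Pminus\<close> and as 1 under \<open>Pplus\<close>.\<close>
    have "Pminus (X + Y) = - (Pminus (matB ** (matB ** X + Y ** matB)))"
      "Pplus (X - Y) = - (Pplus (matB ** (matB ** X + Y ** matB)))" for X Y :: "complex^2^2"
      by (simp_all add: Pminus_def Pplus_def matB_def mat2_simps algebra_simps)
    then have 1: "Pminus (Kx (x, t) + Kt (x, t)) = Pminus (potential p q x ** K (x, t))"
      "Pplus (Kx (x, t) - Kt (x, t)) = Pplus (potential p q x ** K (x, t))"
      using K(2)[OF that] by (simp_all add: matrix_mul_assoc linear_neg[OF linear_Pminus] linear_neg[OF linear_Pplus]
          bounded_bilinear.minus_right[OF bounded_bilinear_matrix_matrix_mult])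
    have 2: "potential p q x ** K (x, t) = potential p q x ** Pminus (K (x, t)) + potential p q x ** Pplus (K (x, t))"
      by (simp add: Pplus_plus_Pminus flip: matrix_add_ldistrib)
    show "Pminus (Kx (x, t) + Kt (x, t)) = potential p q x ** Pplus (K (x, t))"
      "Pplus (Kx (x, t) - Kt (x, t)) = potential p q x ** Pminus (K (x, t))"
      unfolding 1
      unfolding 2 linear_add[OF linear_Pminus] linear_add[OF linear_Pplus] potential_Pplus potential_Pminus by simp_all
  qed
  have dirder: "((\<lambda>s. K (c s)) has_vector_derivative (fst d *\<^sub>R Kx (c u) + snd d *\<^sub>R Kt (c u))) (at u within I)"
    if c: "(c has_vector_derivative d) (at u within I)" and sub: "\<And>u. u \<in> I \<Longrightarrow> c u \<in> S" and u: "u \<in> I" for c d u and I :: "real set"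
  proof -
    have "(K has_derivative (\<lambda>(h, k). h *\<^sub>R Kx (c u) + k *\<^sub>R Kt (c u))) (at (c u) within c ` I)"
      using K(1)[of "fst (c u)" "snd (c u)"] sub u by (auto intro!: has_derivative_subset[where s = S])
    from vector_derivative_diff_chain_within[OF c this]
    show ?thesis by (simp add: o_def case_prod_unfold)
  qed
  have "((\<lambda>u. Pminus (K (u + \<eta>, u - \<eta>))) has_vector_derivative potential p q (u + \<eta>) ** Pplus (K (u + \<eta>, u - \<eta>)))
      (at u within {\<xi>0..\<xi>})" if sub: "{\<xi>0..\<xi>} \<times> {\<eta>} \<subseteq> T" and u: "u \<in> {\<xi>0..\<xi>}" for \<xi>0 \<xi> \<eta> u
  proof -
    have S: "(u + \<eta>, u - \<eta>) \<in> S" if "u \<in> {\<xi>0..\<xi>}" for u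
      using T[of u \<eta>] sub that by blast
    have "((\<lambda>u. (u + \<eta>, u - \<eta>)) has_vector_derivative (1, 1)) (at u within {\<xi>0..\<xi>})"
      by (intro has_vector_derivative_Pair) (auto intro!: derivative_eq_intros)
    from dirder[OF this S u]
    have "((\<lambda>u. Pminus (K (u + \<eta>, u - \<eta>))) has_vector_derivative
        Pminus (Kx (u + \<eta>, u - \<eta>) + Kt (u + \<eta>, u - \<eta>))) (at u within {\<xi>0..\<xi>})"
      using bounded_linear.has_vector_derivative[OF bounded_linear_Pminus] by fastforce
    then show ?thesis by (simp add: alg(1)[OF S[OF u]])
  qed
  moreover have "((\<lambda>v. Pplus (K (\<xi> + v, \<xi> - v))) has_vector_derivative potential p q (\<xi> + v) ** Pminus (K (\<xi> + v, \<xi> - v)))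
      (at v within {\<eta>0..\<eta>})" if sub: "{\<xi>} \<times> {\<eta>0..\<eta>} \<subseteq> T" and v: "v \<in> {\<eta>0..\<eta>}" for \<eta>0 \<xi> \<eta> v
  proof -
    have S: "(\<xi> + v, \<xi> - v) \<in> S" if "v \<in> {\<eta>0..\<eta>}" for v
      using T[of \<xi> v] sub that by blast
    have "((\<lambda>v. (\<xi> + v, \<xi> - v)) has_vector_derivative (1, -1)) (at v within {\<eta>0..\<eta>})"
      by (intro has_vector_derivative_Pair) (auto intro!: derivative_eq_intros)
    from dirder[OF this S v]
    have "((\<lambda>v. Pplus (K (\<xi> + v, \<xi> - v))) has_vector_derivative
        Pplus (Kx (\<xi> + v, \<xi> - v) - Kt (\<xi> + v, \<xi> - v))) (at v within {\<eta>0..\<eta>})"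
      using bounded_linear.has_vector_derivative[OF bounded_linear_Pplus] by fastforce
    then show ?thesis by (simp add: alg(2)[OF S[OF v]])
  qed
  ultimately show ?thesis unfolding char_solution_def using cont by simp
qed

text \<open>The common shape of \<open>O1\<close> to \<open>O4\<close>: \<open>P\<close> goes with
  even and \<open>R\<close> with odd powers of \<open>t\<close>, so that one computation treats all
  four families.\<close>

definition wave_matrix ::
    "(nat \<Rightarrow> real \<Rightarrow> complex^2^2) \<Rightarrow> (nat \<Rightarrow> real \<Rightarrow> complex^2^2) \<Rightarrow> nat \<Rightarrow> real \<times> real \<Rightarrow> complex^2^2" where
  "wave_matrix P R m = (\<lambda>(x, t). \<Sum>k\<le>m. (real (m choose k) * t ^ k) *\<^sub>R (if even k then P (m - k) x else R (m - k) x))"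

text \<open>The assumptions mean
  \<open>B P\<^sub>n' + Q P\<^sub>n = - n R\<^sub>n\<^sub>-\<^sub>1 B\<close> and the same with
  \<open>P\<close> and \<open>R\<close> exchanged. The \<open>t\<close>-derivatives, shifted by one
  index, cancel these terms because
  \<open>(k + 1) * (m choose (k + 1)) = (m - k) * (m choose k)\<close>.\<close>

lemma wave_matrix_solves:
  assumes pq: "continuous_on {0..b} p" "continuous_on {0..b} q"
    and P: "\<And>n. matrix_dirac_image_on b p q (P n) (\<lambda>x. - real n *\<^sub>R (R (n - 1) x ** matB))"
    and R: "\<And>n. matrix_dirac_image_on b p q (R n) (\<lambda>x. - real n *\<^sub>R (P (n - 1) x ** matB))"
  shows "solves_on ({0..b} \<times> UNIV) p q (wave_matrix P R m)"
proof -
  define F where "F = (\<lambda>k x. if even k then P (m - k) x else R (m - k) x)"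
  \<comment> \<open>For \<open>k \<ge> m\<close> the factor \<open>real (m - k)\<close> is 0, which
    neutralizes the truncated index in \<open>F (Suc k)\<close>.\<close>
  define G where "G = (\<lambda>k x. - real (m - k) *\<^sub>R (F (Suc k) x ** matB))"
  define F' where "F' = (\<lambda>k x. potential p q x ** F k x - matB ** G k x)"
  note mm = bounded_bilinear_matrix_matrix_mult
  have dF: "(F k has_vector_derivative F' k x) (at x within {0..b})" if "x \<in> {0..b}" for k x
    using P[of "m - k"] R[of "m - k"] that
    by (cases "even k") (auto simp: matrix_dirac_image_on_def F_def[abs_def] F'_def G_def)
  have cF: "continuous_on {0..b} (F k)" for k by (rule continuous_on_vector_derivative, erule dF)
  have cG: "continuous_on {0..b} (G k)" for k
    unfolding G_def by (intro continuous_intros bounded_bilinear.continuous_on[OF mm] cF)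
  have cF': "continuous_on {0..b} (F' k)" for k
    unfolding F'_def by (intro continuous_intros bounded_bilinear.continuous_on[OF mm] cF cG continuous_on_potential pq)
  define Kx where "Kx = (\<lambda>z. \<Sum>k\<le>m. (real (m choose k) * snd z ^ k) *\<^sub>R F' k (fst z))"
  define Kt where "Kt = (\<lambda>z. \<Sum>k\<le>m. (real (m choose k) * (real k * snd z ^ (k - 1))) *\<^sub>R F k (fst z))"
  have K: "wave_matrix P R m = (\<lambda>z. \<Sum>k\<le>m. (real (m choose k) * snd z ^ k) *\<^sub>R F k (fst z))"
    by (simp add: wave_matrix_def F_def case_prod_unfold)
  let ?S = "{0..b} \<times> (UNIV :: real set)"
  have der: "(wave_matrix P R m has_derivative (\<lambda>(h, k). h *\<^sub>R Kx z + k *\<^sub>R Kt z)) (at z within ?S)" if z: "z \<in> ?S" for z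
  proof -
    have comp: "((\<lambda>z. F k (fst z)) has_derivative (\<lambda>h. fst h *\<^sub>R F' k (fst z))) (at z within ?S)" for k
    proof (rule has_derivative_in_compose[where f = fst and g = "F k"])
      show "(F k has_derivative (\<lambda>h. h *\<^sub>R F' k (fst z))) (at (fst z) within fst ` ?S)"
        using dF[of "fst z" k] z by (auto simp: has_vector_derivative_def)
    qed (auto intro!: derivative_eq_intros)
    have summand: "((\<lambda>z. (real (m choose k) * snd z ^ k) *\<^sub>R F k (fst z)) has_derivative
        (\<lambda>h. (real (m choose k) * snd z ^ k) *\<^sub>R (fst h *\<^sub>R F' k (fst z))
           + (real (m choose k) * (real k * snd z ^ (k - 1) * snd h)) *\<^sub>R F k (fst z))) (at z within ?S)" for k
      by (intro has_derivative_scaleR comp) (auto intro!: derivative_eq_intros)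
    have "(\<lambda>(h, k). h *\<^sub>R Kx z + k *\<^sub>R Kt z) =
        (\<lambda>h. \<Sum>k\<le>m. (real (m choose k) * snd z ^ k) *\<^sub>R (fst h *\<^sub>R F' k (fst z))
           + (real (m choose k) * (real k * snd z ^ (k - 1) * snd h)) *\<^sub>R F k (fst z))"
      by (simp add: fun_eq_iff Kx_def Kt_def sum.distrib scaleR_sum_right mult_ac)
    then show ?thesis unfolding K by (simp only:) (intro has_derivative_sum summand)
  qed
  have eq: "matB ** Kx z + Kt z ** matB = - (matQ p q (fst z) ** wave_matrix P R m z)" for z
  proof -
    define E where "E = (\<lambda>k. F k (fst z) ** matB)"
    note lin = bounded_bilinear.sum_right[OF mm] bounded_bilinear.sum_left[OF mm]
      bounded_bilinear.scaleR_right[OF mm] bounded_bilinear.scaleR_left[OF mm]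
      bounded_bilinear.diff_right[OF mm]
    have "matB ** Kx z = (\<Sum>k\<le>m. (real (m choose k) * snd z ^ k) *\<^sub>R (G k (fst z) - matQ p q (fst z) ** F k (fst z)))"
      by (simp add: Kx_def lin F'_def matB_mult matB_potential)
    also have "\<dots> = (\<Sum>k\<le>m. (real (m choose k) * snd z ^ k) *\<^sub>R G k (fst z)) - matQ p q (fst z) ** wave_matrix P R m z"
      by (simp add: K lin scaleR_diff_right sum_subtractf)
    finally have 1: "matB ** Kx z = (\<Sum>k\<le>m. (real (m choose k) * snd z ^ k) *\<^sub>R G k (fst z)) - matQ p q (fst z) ** wave_matrix P R m z" .
    have 2: "Kt z ** matB = (\<Sum>k\<le>m. (real (m choose k) * (real k * snd z ^ (k - 1))) *\<^sub>R E k)"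
      by (simp add: Kt_def lin E_def)
    have "(\<Sum>k\<le>m. (real (m choose k) * (real k * snd z ^ (k - 1))) *\<^sub>R E k)
        = (\<Sum>k<m. (real (m choose Suc k) * (real (Suc k) * snd z ^ k)) *\<^sub>R E (Suc k))"
      by (simp add: sum.atMost_shift)
    also have "\<dots> = (\<Sum>k<m. (real (m choose k) * snd z ^ k) *\<^sub>R (real (m - k) *\<^sub>R E (Suc k)))"
    proof (rule sum.cong[OF refl])
      fix k
      have "Suc k * (m choose Suc k) = (m - k) * (m choose k)"
        by (metis Suc_times_binomial_add binomial_absorb_comp binomial_absorption)
      then have "real (Suc k) * real (m choose Suc k) = real (m - k) * real (m choose k)"
        by (simp only: of_nat_mult[symmetric])
      then show "(real (m choose Suc k) * (real (Suc k) * snd z ^ k)) *\<^sub>R E (Suc k)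
          = (real (m choose k) * snd z ^ k) *\<^sub>R (real (m - k) *\<^sub>R E (Suc k))"
        by (simp add: mult_ac)
    qed
    also have "\<dots> = (\<Sum>k\<le>m. (real (m choose k) * snd z ^ k) *\<^sub>R (real (m - k) *\<^sub>R E (Suc k)))"
      by (simp add: lessThan_Suc_atMost[symmetric])
    also have "\<dots> = - (\<Sum>k\<le>m. (real (m choose k) * snd z ^ k) *\<^sub>R G k (fst z))"
      by (simp add: G_def E_def sum_negf)
    finally show ?thesis using 1 2 by simp
  qed
  show ?thesis
    unfolding solves_on_def
  proof (rule exI[of _ Kx], rule exI[of _ Kt], intro conjI ballI)
    show "continuous_on ?S Kx" "continuous_on ?S Kt"
      unfolding Kx_def Kt_def
      by (intro continuous_intros continuous_on_compose2[OF cF] continuous_on_compose2[OF cF']; auto)+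
    fix z assume "z \<in> ?S"
    with der[of z] eq[of z] show "case z of (x, t) \<Rightarrow>
        (wave_matrix P R m has_derivative (\<lambda>(h, k). h *\<^sub>R Kx (x, t) + k *\<^sub>R Kt (x, t))) (at (x, t) within ?S) \<and>
        matB ** Kx (x, t) + Kt (x, t) ** matB = - (matQ p q x ** wave_matrix P R m (x, t))"
      by (cases z) simp
  qed
qed

lemma wave_matrix_at_0:
  assumes "\<And>n. 0 < n \<Longrightarrow> P n 0 = 0" "\<And>n. 0 < n \<Longrightarrow> R n 0 = 0"
  shows "wave_matrix P R m (0, t) = t ^ m *\<^sub>R (if even m then P 0 0 else R 0 0)"
proof -
  have "wave_matrix P R m (0, t) = (\<Sum>k\<in>{m}. (real (m choose k) * t ^ k) *\<^sub>R (if even k then P (m - k) 0 else R (m - k) 0))"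
    unfolding wave_matrix_def prod.case using assms by (intro sum.mono_neutral_right) auto
  then show ?thesis by simp
qed

text \<open>Padding with zeros to all \<open>k \<le> m\<close> puts both columns of a wave matrix
  over the same index set.\<close>

lemma wave_even_odd_eq:
  "wave_even V m x t = (\<Sum>k\<le>m. (real (m choose k) * t ^ k) *\<^sub>R (if even k then V (m - k) x else 0))"
  "wave_odd V m x t = (\<Sum>k\<le>m. (real (m choose k) * t ^ k) *\<^sub>R (if even k then 0 else V (m - k) x))"
proof -
  have sc: "(of_nat c * complex_of_real t ^ k) *s v = (real c * t ^ k) *\<^sub>R v" for c k and v :: "complex^2"
    by (simp only: vec_eq_iff vector_scaleR_component vector_smult_component scaleR_conv_of_real[where 'a = complex]) simp
  show "wave_even V m x t = (\<Sum>k\<le>m. (real (m choose k) * t ^ k) *\<^sub>R (if even k then V (m - k) x else 0))"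
    unfolding wave_even_def sc by (rule sum.mono_neutral_cong_left) auto
  show "wave_odd V m x t = (\<Sum>k\<le>m. (real (m choose k) * t ^ k) *\<^sub>R (if even k then 0 else V (m - k) x))"
    unfolding wave_odd_def sc by (rule sum.mono_neutral_cong_left) auto
qed

lemma columns2_sum_scaleR:
  "columns2 (\<Sum>k\<in>A. c k *\<^sub>R u k) (\<Sum>k\<in>A. c k *\<^sub>R v k) = (\<Sum>k\<in>A. c k *\<^sub>R columns2 (u k) (v k))"
  by (simp add: columns2_def transpose_def vec_eq_iff forall_2 sum_component)

lemma O_eq_wave_matrix:
  "O1 p f g m = wave_matrix (\<lambda>n x. columns2 (Phi p f g n x) 0) (\<lambda>n x. columns2 0 (- Psi p f g n x)) m"
  "O2 p f g m = wave_matrix (\<lambda>n x. columns2 0 (Phi p f g n x)) (\<lambda>n x. columns2 (Psi p f g n x) 0) m"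
  "O3 p f g m = wave_matrix (\<lambda>n x. columns2 (Psi p f g n x) 0) (\<lambda>n x. columns2 0 (Phi p f g n x)) m"
  "O4 p f g m = wave_matrix (\<lambda>n x. columns2 0 (Psi p f g n x)) (\<lambda>n x. columns2 (- Phi p f g n x) 0) m"
proof -
  have neg: "- wave_odd V m x t = (\<Sum>k\<le>m. (real (m choose k) * t ^ k) *\<^sub>R (if even k then 0 else - V (m - k) x))" for V x t
    by (simp add: wave_even_odd_eq flip: sum_negf) (rule sum.cong, auto)
  show "O1 p f g m = wave_matrix (\<lambda>n x. columns2 (Phi p f g n x) 0) (\<lambda>n x. columns2 0 (- Psi p f g n x)) m"
    "O2 p f g m = wave_matrix (\<lambda>n x. columns2 0 (Phi p f g n x)) (\<lambda>n x. columns2 (Psi p f g n x) 0) m"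
    "O3 p f g m = wave_matrix (\<lambda>n x. columns2 (Psi p f g n x) 0) (\<lambda>n x. columns2 0 (Phi p f g n x)) m"
    "O4 p f g m = wave_matrix (\<lambda>n x. columns2 0 (Psi p f g n x)) (\<lambda>n x. columns2 (- Phi p f g n x) 0) m"
    unfolding O1_def O2_def O3_def O4_def wave_matrix_def neg
    unfolding wave_even_odd_eq columns2_sum_scaleR
    by (auto simp: fun_eq_iff intro!: sum.cong)
qed

context nonvanishing_solution
begin

lemma O_solves:
  assumes "W \<in> {O1 p f g m, O2 p f g m, O3 p f g m, O4 p f g m}"
  shows "solves_on ({0..b} \<times> UNIV) p q W"
proof -
  have zero: "dirac_image_on b p q (\<lambda>x. 0) (\<lambda>x. 0)" by (simp add: dirac_image_on_def)
  \<comment> \<open>Right multiplication by \<open>matB\<close> exchanges the columns up to a sign;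
    this is why even and odd powers of \<open>t\<close> occupy opposite columns.\<close>
  have cB: "columns2 u v ** matB = columns2 (- v) u" for u v
    by (simp add: columns2_def transpose_def matB_def mat2_simps)
  have cs: "r *\<^sub>R columns2 u v = columns2 (r *\<^sub>R u) (r *\<^sub>R v)" for r u v
    by (simp add: columns2_def transpose_def vec_eq_iff forall_2)
  have mPhi: "dirac_image_on b p q (\<lambda>x. - Phi p f g n x) (\<lambda>x. real n *\<^sub>R Psi p f g (n - 1) x)" for n
    by (rule dirac_image_on_scale[OF Phi_dirac[of n], where c = "-1"]) (simp_all add: vec_eq_iff)
  have mPsi: "dirac_image_on b p q (\<lambda>x. - Psi p f g n x) (\<lambda>x. - real n *\<^sub>R Phi p f g (n - 1) x)" for n
    by (rule dirac_image_on_scale[OF Psi_dirac[of n], where c = "-1"]) (simp_all add: vec_eq_iff)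
  note cols = matrix_dirac_image_on_columns2[OF Phi_dirac zero] matrix_dirac_image_on_columns2[OF zero Phi_dirac]
    matrix_dirac_image_on_columns2[OF Psi_dirac zero] matrix_dirac_image_on_columns2[OF zero Psi_dirac]
    matrix_dirac_image_on_columns2[OF mPhi zero] matrix_dirac_image_on_columns2[OF zero mPsi]
  show ?thesis
    using assms unfolding O_eq_wave_matrix
    by (elim insertE emptyE; hypsubst; intro wave_matrix_solves pq; unfold cB cs)
      (use cols in simp_all)
qed

lemma O_at_0:
  "O1 p f g m (0, t) = t ^ m *\<^sub>R (if even m then columns2 (vector [1, 0]) 0 else columns2 0 (- vector [0, 1]))"
  "O2 p f g m (0, t) = t ^ m *\<^sub>R (if even m then columns2 0 (vector [1, 0]) else columns2 (vector [0, 1]) 0)"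
  "O3 p f g m (0, t) = t ^ m *\<^sub>R (if even m then columns2 (vector [0, 1]) 0 else columns2 0 (vector [1, 0]))"
  "O4 p f g m (0, t) = t ^ m *\<^sub>R (if even m then columns2 0 (vector [0, 1]) else columns2 (- vector [1, 0]) 0)"
proof -
  have "columns2 0 0 = 0" by (simp add: columns2_def transpose_def vec_eq_iff forall_2)
  then show "O1 p f g m (0, t) = t ^ m *\<^sub>R (if even m then columns2 (vector [1, 0]) 0 else columns2 0 (- vector [0, 1]))"
    "O2 p f g m (0, t) = t ^ m *\<^sub>R (if even m then columns2 0 (vector [1, 0]) else columns2 (vector [0, 1]) 0)"
    "O3 p f g m (0, t) = t ^ m *\<^sub>R (if even m then columns2 (vector [0, 1]) 0 else columns2 0 (vector [1, 0]))"
    "O4 p f g m (0, t) = t ^ m *\<^sub>R (if even m then columns2 0 (vector [0, 1]) else columns2 (- vector [1, 0]) 0)"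
    unfolding O_eq_wave_matrix by (subst wave_matrix_at_0; simp add: Phi_at_0 Psi_at_0)+
qed

end

section \<open>Completeness\<close>

text \<open>The coefficients are wanted as vectors, one per power of \<open>t\<close>, to be matched
  with the wave matrices order by order. The coordinates of the approximating polynomial may differ
  in degree and are padded with zeros.\<close>

lemma polynomial_approximation:
  fixes h :: "real \<Rightarrow> 'b::euclidean_space"
  assumes "compact S" "continuous_on S h" "0 < \<epsilon>"
  obtains N C where "\<And>t. t \<in> S \<Longrightarrow> norm (h t - (\<Sum>n\<le>N. t ^ n *\<^sub>R C n)) < \<epsilon>"
proof -
  obtain P where P: "polynomial_function P" "\<And>t. t \<in> S \<Longrightarrow> norm (h t - P t) < \<epsilon>"
    using Stone_Weierstrass_polynomial_function[OF assms] by blast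
  have "\<exists>a n. (\<lambda>t. P t \<bullet> i) = (\<lambda>t. \<Sum>k\<le>n. a k * t ^ k)" for i :: 'b
    using P(1) unfolding real_polynomial_function_iff_sum[symmetric] polynomial_function_def
    by (auto simp: o_def dest!: spec[of _ "\<lambda>v. v \<bullet> i"] intro: bounded_linear_inner_left)
  then obtain a n where an: "\<And>i t. P t \<bullet> i = (\<Sum>k\<le>n i. a i k * t ^ k)"
    by (metis (no_types))
  define N where "N = (\<Sum>i\<in>Basis. n (i::'b))"
  have nN: "n i \<le> N" if "i \<in> Basis" for i :: 'b
    unfolding N_def using that by (intro member_le_sum) auto
  define C where "C = (\<lambda>k. \<Sum>i\<in>Basis. (if k \<le> n i then a i k else 0) *\<^sub>R (i::'b))"
  have "P t = (\<Sum>k\<le>N. t ^ k *\<^sub>R C k)" for t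
  proof -
    have "P t = (\<Sum>i\<in>Basis. (P t \<bullet> i) *\<^sub>R i)" by (simp add: euclidean_representation)
    also have "\<dots> = (\<Sum>i\<in>Basis. \<Sum>k\<le>N. (t ^ k * (if k \<le> n i then a i k else 0)) *\<^sub>R i)"
    proof (rule sum.cong[OF refl])
      fix i :: 'b assume i: "i \<in> Basis"
      have "P t \<bullet> i = (\<Sum>k\<le>N. t ^ k * (if k \<le> n i then a i k else 0))"
        unfolding an by (rule sum.mono_neutral_cong_left) (use nN[OF i] in auto)
      then show "(P t \<bullet> i) *\<^sub>R i = (\<Sum>k\<le>N. (t ^ k * (if k \<le> n i then a i k else 0)) *\<^sub>R i)"
        by (simp add: scaleR_sum_left)
    qed
    also have "\<dots> = (\<Sum>k\<le>N. t ^ k *\<^sub>R C k)"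
      unfolding C_def scaleR_sum_right scaleR_scaleR by (rule sum.swap)
    finally show ?thesis .
  qed
  then show ?thesis using P(2) by (intro that[where N = N and C = C]) simp
qed

section \<open>Linear combinations of wave matrices\<close>

lemma bounded_linear_cscale: "bounded_linear (cscale c)"
  by (auto intro!: linearI simp: cscale_def vec_eq_iff algebra_simps simp flip: linear_conv_bounded_linear)

lemma char_solution_cscale:
  assumes "char_solution S A H"
  shows "char_solution S A (\<lambda>z. cscale c (H z))"
proof -
  have P: "Pminus (cscale c X) = cscale c (Pminus X)" "Pplus (cscale c X) = cscale c (Pplus X)"
    and M: "Y ** cscale c X = cscale c (Y ** X)" for X Y
    by (simp_all add: Pminus_def Pplus_def cscale_def matB_def mat2_simps algebra_simps)
  show ?thesis
    unfolding char_solution_def P M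
    by (intro conjI allI impI ballI bounded_linear.continuous_on[OF bounded_linear_cscale]
        bounded_linear.has_vector_derivative[OF bounded_linear_cscale] char_solutionD[OF assms])
qed

lemma char_solution_zero: "char_solution S A (\<lambda>_. 0)"
  by (simp add: char_solution_def linear_0[OF linear_Pplus] linear_0[OF linear_Pminus]
      bounded_bilinear.zero_right[OF bounded_bilinear_matrix_matrix_mult])

lemma char_solution_add:
  assumes "char_solution S A H" "char_solution S A H'"
  shows "char_solution S A (\<lambda>z. H z + H' z)"
  using char_solution_diff[OF assms(1) char_solution_diff[OF char_solution_zero assms(2)]] by simp

lemma char_solution_sum:
  fixes N :: nat
  assumes "\<And>n. char_solution S A (H n)"
  shows "char_solution S A (\<lambda>z. \<Sum>n\<le>N. H n z)"
  by (induction N) (simp_all add: assms char_solution_add)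

context nonvanishing_solution
begin

definition wave_combination ::
    "(nat \<Rightarrow> complex) \<Rightarrow> (nat \<Rightarrow> complex) \<Rightarrow> (nat \<Rightarrow> complex) \<Rightarrow> (nat \<Rightarrow> complex) \<Rightarrow> nat \<Rightarrow> real \<times> real \<Rightarrow> complex^2^2" where
  "wave_combination \<alpha> \<beta> \<gamma> \<delta> N z = (\<Sum>n\<le>N. cscale (\<alpha> n) (O1 p f g n z) + cscale (\<beta> n) (O2 p f g n z)
      + cscale (\<gamma> n) (O3 p f g n z) + cscale (\<delta> n) (O4 p f g n z))"

lemma wave_combination_char_solution:
  assumes "\<And>\<xi> \<eta>. (\<xi>, \<eta>) \<in> T \<Longrightarrow> 0 \<le> \<xi> + \<eta> \<and> \<xi> + \<eta> \<le> b"
  shows "char_solution T (potential p q) (\<lambda>(\<xi>, \<eta>). wave_combination \<alpha> \<beta> \<gamma> \<delta> N (\<xi> + \<eta>, \<xi> - \<eta>))"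
proof -
  have sol: "char_solution T (potential p q) (\<lambda>z. W (fst z + snd z, fst z - snd z))"
    if "W \<in> {O1 p f g m, O2 p f g m, O3 p f g m, O4 p f g m}" for W m
    using solves_on_imp_char_solution[OF O_solves[OF that], of T] assms by (auto simp: case_prod_unfold)
  show ?thesis
    unfolding wave_combination_def case_prod_unfold
    by (intro char_solution_sum char_solution_add char_solution_cscale sol) auto
qed

lemma wave_combination_at_0:
  obtains \<alpha> \<beta> \<gamma> \<delta> where "\<And>N t. wave_combination \<alpha> \<beta> \<gamma> \<delta> N (0, t) = (\<Sum>n\<le>N. t ^ n *\<^sub>R C n)"
proof (rule that, unfold wave_combination_def, rule sum.cong[OF refl])
  fix n t
  \<comment> \<open>Coefficients read off from \<open>O_at_0\<close>: in even orders
    \<open>O1\<close> to \<open>O4\<close> give the matrix units 11, 12, 21, 22, in odd orders 22,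
    21, 12, 11 with minus signs for \<open>O1\<close> and \<open>O4\<close>.\<close>
  show "cscale (if even n then C n $ 1 $ 1 else - C n $ 2 $ 2) (O1 p f g n (0, t))
    + cscale (if even n then C n $ 1 $ 2 else C n $ 2 $ 1) (O2 p f g n (0, t))
    + cscale (if even n then C n $ 2 $ 1 else C n $ 1 $ 2) (O3 p f g n (0, t))
    + cscale (if even n then C n $ 2 $ 2 else - C n $ 1 $ 1) (O4 p f g n (0, t)) = t ^ n *\<^sub>R C n"
    unfolding O_at_0
    by (cases "even n") (simp_all add: vec_eq_iff forall_2 cscale_def columns2_def transpose_def scaleR_conv_of_real[where 'a = complex])
qed

end

section \<open>Continuation of mild solutions and the approximation\<close>

lemma continuous_bounded_clamp:
  fixes h :: "real \<Rightarrow> 'a::metric_space"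
  assumes "continuous_on {0..b} h"
  shows "continuous_on UNIV (\<lambda>x. h (clamp 0 b x))" "bounded (range (\<lambda>x. h (clamp 0 b x)))"
  using assms by (simp_all add: clamp_continuous_on clamp_bounded cbox_interval compact_imp_bounded
      compact_continuous_image)

text \<open>Continuing the potential and the Goursat data as constants makes the solution continuable to the
  whole plane, in particular to the domain of dependence of the line \<open>x = 0\<close> for the triangle.\<close>

lemma mild_solution_extension:
  assumes b: "0 < b" and pq: "continuous_on {0..b} p" "continuous_on {0..b} q" and K: "mild_solution b p q K"
  obtains G where "continuous_on UNIV G"
    "char_solution {(\<xi>, \<eta>). 0 \<le> \<xi> + \<eta> \<and> \<xi> + \<eta> \<le> b} (potential p q) G"
    "\<And>\<xi> \<eta>. (\<xi>, \<eta>) \<in> char_triangle b \<Longrightarrow> K (\<xi> + \<eta>, \<xi> - \<eta>) = G (\<xi>, \<eta>)"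
proof -
  define H where "H = (\<lambda>(\<xi>, \<eta>). K (\<xi> + \<eta>, \<xi> - \<eta>))"
  have H: "char_solution (char_triangle b) (potential p q) H"
    unfolding H_def by (rule mild_imp_char_solution[OF K pq])
  define p' where "p' = (\<lambda>x. p (clamp 0 b x))"
  define q' where "q' = (\<lambda>x. q (clamp 0 b x))"
  have pot': "potential p' q' x = potential p q (clamp 0 b x)" for x
    by (simp add: p'_def q'_def matQ_def)
  have H0: "continuous_on {0..b} (\<lambda>\<eta>. H (0, \<eta>))" "continuous_on {0..b} (\<lambda>\<xi>. H (\<xi>, 0))"
    by (auto intro!: continuous_on_compose2[OF char_solutionD(1)[OF H]] continuous_intros simp: char_triangle_def)
  obtain G where G: "char_solution UNIV (potential p' q') G"
    "\<And>\<eta>. Pminus (G (0, \<eta>)) = Pminus (H (0, clamp 0 b \<eta>))" "\<And>\<xi>. Pplus (G (\<xi>, 0)) = Pplus (H (clamp 0 b \<xi>, 0))"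
  proof (rule char_solution_goursat[of p' q' "\<lambda>\<eta>. H (0, clamp 0 b \<eta>)" "\<lambda>\<xi>. H (clamp 0 b \<xi>, 0)"])
    show "bounded (range (potential p' q'))"
      unfolding pot' by (intro continuous_bounded_clamp continuous_on_potential pq)
  qed (use continuous_bounded_clamp[OF pq(1)] continuous_bounded_clamp[OF pq(2)]
      continuous_bounded_clamp[OF H0(1)] continuous_bounded_clamp[OF H0(2)] in \<open>auto simp: p'_def q'_def\<close>)
  have G': "char_solution {(\<xi>, \<eta>). 0 \<le> \<xi> + \<eta> \<and> \<xi> + \<eta> \<le> b} (potential p q) G"
    by (rule char_solution_restrict[OF G(1)]) (auto simp: pot' clamp_cancel_cbox cbox_interval)
  obtain M where M: "\<And>x X. x \<in> {0..b} \<Longrightarrow> norm (potential p q x ** Pplus X) \<le> M * norm X"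
    "\<And>x X. x \<in> {0..b} \<Longrightarrow> norm (potential p q x ** Pminus X) \<le> M * norm X" "0 \<le> M"
    using potential_bound[OF compact_imp_bounded[OF compact_continuous_image[OF continuous_on_potential[OF pq] compact_Icc]]]
    by blast
  have tri: "compact (char_triangle b)"
  proof -
    have "char_triangle b = {z. 0 \<le> fst z} \<inter> {z. 0 \<le> snd z} \<inter> {z. fst z + snd z \<le> b}"
      by (auto simp: char_triangle_def)
    then have "closed (char_triangle b)"
      by (auto intro!: closed_Int closed_Collect_le continuous_intros)
    moreover have "char_triangle b \<subseteq> cbox (0, 0) (b, b)" by (auto simp: char_triangle_def cbox_Pair_eq)
    ultimately show ?thesis by (metis bounded_cbox bounded_subset compact_eq_bounded_closed)
  qed
  have W: "char_solution (char_triangle b) (potential p q) (\<lambda>z. H z - G z)"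
    by (intro char_solution_diff H char_solution_restrict[OF G']) (auto simp: char_triangle_def)
  \<comment> \<open>Uniqueness for the Goursat problem: the stability estimate with
    \<open>\<delta> = 0\<close>, as \<open>H\<close> and \<open>G\<close> share their data on the
    axes.\<close>
  have "norm (H z - G z) \<le> 4 * 0 * exp ((4 * M + 1) * b)" if "z \<in> char_triangle b" for z
  proof (rule char_solution_stable[OF W tri _ M _ _ that])
    fix \<xi> \<eta> assume z: "(\<xi>, \<eta>) \<in> char_triangle b"
    then show "\<xi> + \<eta> \<in> {0..b}" by (auto simp: char_triangle_def)
    have "Pminus (H (0, \<eta>) - G (0, \<eta>)) = 0" "Pplus (H (\<xi>, 0) - G (\<xi>, 0)) = 0"
      using z by (simp_all add: linear_diff[OF linear_Pminus] linear_diff[OF linear_Pplus] G(2,3) clamp_cancel_cbox cbox_interval char_triangle_def)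
    then show "\<exists>\<xi>0\<le>\<xi>. {\<xi>0..\<xi>} \<times> {\<eta>} \<subseteq> char_triangle b \<and> norm (Pminus (H (\<xi>0, \<eta>) - G (\<xi>0, \<eta>))) \<le> 0"
      "\<exists>\<eta>0\<le>\<eta>. {\<xi>} \<times> {\<eta>0..\<eta>} \<subseteq> char_triangle b \<and> norm (Pplus (H (\<xi>, \<eta>0) - G (\<xi>, \<eta>0))) \<le> 0"
      using z by (auto simp: char_triangle_def intro!: exI[of _ 0])
  qed
  then have "H z = G z" if "z \<in> char_triangle b" for z using that by fastforce
  then show ?thesis
    using char_solutionD(1)[OF G(1)] G' by (intro that[of G]) (auto simp: H_def)
qed

context nonvanishing_solution
begin

lemma wave_matrices_dense:
  assumes K: "mild_solution b p q K" and \<epsilon>: "0 < \<epsilon>"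
  obtains \<alpha> \<beta> \<gamma> \<delta> N where "\<And>z. z \<in> OmegaPlus b \<Longrightarrow> norm (K z - wave_combination \<alpha> \<beta> \<gamma> \<delta> N z) \<le> \<epsilon>"
proof -
  obtain G where G: "continuous_on UNIV G"
    "char_solution {(\<xi>, \<eta>). 0 \<le> \<xi> + \<eta> \<and> \<xi> + \<eta> \<le> b} (potential p q) G"
    "\<And>\<xi> \<eta>. (\<xi>, \<eta>) \<in> char_triangle b \<Longrightarrow> K (\<xi> + \<eta>, \<xi> - \<eta>) = G (\<xi>, \<eta>)"
    using mild_solution_extension[OF b pq K] by blast
  obtain M where M: "\<And>x X. x \<in> {0..b} \<Longrightarrow> norm (potential p q x ** Pplus X) \<le> M * norm X"
    "\<And>x X. x \<in> {0..b} \<Longrightarrow> norm (potential p q x ** Pminus X) \<le> M * norm X" "0 \<le> M"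
    using potential_bound[OF compact_imp_bounded[OF compact_continuous_image[OF continuous_on_potential[OF pq] compact_Icc]]]
    by blast
  obtain c1 where c1: "0 < c1" "\<And>X. norm (Pplus X) \<le> norm X * c1"
    using bounded_linear.pos_bounded[OF bounded_linear_Pplus] by metis
  obtain c2 where c2: "0 < c2" "\<And>X. norm (Pminus X) \<le> norm X * c2"
    using bounded_linear.pos_bounded[OF bounded_linear_Pminus] by metis
  define E where "E = exp ((4 * M + 1) * b)"
  \<comment> \<open>Compensates the losses to come: \<open>c1 + c2\<close> from projecting the data
    and \<open>4 * E\<close> from the stability estimate, so that the final bound is
    \<epsilon>.\<close>
  define r where "r = \<epsilon> / (4 * E * (c1 + c2))"
  have pos: "0 < E" "0 < r" using \<epsilon> c1 c2 by (simp_all add: E_def r_def)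
  \<comment> \<open>The point \<open>(0, t)\<close> has the characteristic coordinates
    \<open>(t / 2, - t / 2)\<close>.\<close>
  have "continuous_on {-2*b..2*b} (\<lambda>t. G (t / 2, - t / 2))"
    by (intro continuous_on_compose2[OF G(1)] continuous_intros) auto
  then obtain N C where NC: "\<And>t. t \<in> {-2*b..2*b} \<Longrightarrow> norm (G (t / 2, - t / 2) - (\<Sum>n\<le>N. t ^ n *\<^sub>R C n)) < r"
    using polynomial_approximation[OF compact_Icc _ pos(2)] by blast
  obtain \<alpha> \<beta> \<gamma> \<delta> where S: "\<And>N t. wave_combination \<alpha> \<beta> \<gamma> \<delta> N (0, t) = (\<Sum>n\<le>N. t ^ n *\<^sub>R C n)"
    using wave_combination_at_0 by blast
  \<comment> \<open>In the coordinates \<open>(x, t)\<close> this is the trapezoid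
    \<open>0 \<le> x \<le> b\<close>, \<open>\<bar>t\<bar> \<le> 2 * b - x\<close>: it contains the
    triangle, and with each point both characteristic segments back to \<open>x = 0\<close>.\<close>
  define T where "T = {(\<xi>, \<eta>). \<xi> \<le> b \<and> \<eta> \<le> b \<and> 0 \<le> \<xi> + \<eta> \<and> \<xi> + \<eta> \<le> b}"
  define W where "W = (\<lambda>z. G z - wave_combination \<alpha> \<beta> \<gamma> \<delta> N (fst z + snd z, fst z - snd z))"
  have T: "compact T"
  proof -
    have "T = {z. fst z \<le> b} \<inter> {z. snd z \<le> b} \<inter> {z. 0 \<le> fst z + snd z} \<inter> {z. fst z + snd z \<le> b}"
      by (auto simp: T_def)
    then have "closed T"
      by (auto intro!: closed_Int closed_Collect_le continuous_intros)
    moreover have "T \<subseteq> cbox (-b, -b) (b, b)" by (auto simp: T_def cbox_Pair_eq)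
    ultimately show ?thesis by (metis bounded_cbox bounded_subset compact_eq_bounded_closed)
  qed
  have "char_solution T (potential p q) (\<lambda>(\<xi>, \<eta>). wave_combination \<alpha> \<beta> \<gamma> \<delta> N (\<xi> + \<eta>, \<xi> - \<eta>))"
    by (rule wave_combination_char_solution) (auto simp: T_def)
  then have W: "char_solution T (potential p q) W"
    unfolding W_def case_prod_unfold
    by (intro char_solution_diff char_solution_restrict[OF G(2)]) (auto simp: T_def)
  have W0: "norm (W (s, - s)) \<le> r" if "\<bar>s\<bar> \<le> b" for s
    using NC[of "2 * s"] that by (simp add: W_def S abs_le_iff)
  have W0': "norm (Pplus (W (s, - s))) \<le> r * (c1 + c2)" "norm (Pminus (W (s, - s))) \<le> r * (c1 + c2)" if "\<bar>s\<bar> \<le> b" for s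
    using W0[OF that] c1 c2 pos by (auto intro!: order_trans[OF c1(2)] order_trans[OF c2(2)] mult_mono)
  have bound: "norm (W z) \<le> 4 * (r * (c1 + c2)) * exp ((4 * M + 1) * b)" if "z \<in> T" for z
  proof (rule char_solution_stable[OF W T _ M _ _ that])
    fix \<xi> \<eta> assume z: "(\<xi>, \<eta>) \<in> T"
    then show "\<xi> + \<eta> \<in> {0..b}" by (auto simp: T_def)
    have ab: "\<bar>\<xi>\<bar> \<le> b" "\<bar>- \<eta>\<bar> \<le> b" using z by (auto simp: T_def)
    show "\<exists>\<xi>0\<le>\<xi>. {\<xi>0..\<xi>} \<times> {\<eta>} \<subseteq> T \<and> norm (Pminus (W (\<xi>0, \<eta>))) \<le> r * (c1 + c2)"
      \<comment> \<open>The horizontal segment meets the line \<open>x = 0\<close> at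
        \<open>\<xi>0 = - \<eta>\<close>; likewise the vertical one below at
        \<open>\<eta>0 = - \<xi>\<close>.\<close>
      using z W0'(2)[OF ab(2)] by (intro exI[of _ "- \<eta>"]) (auto simp: T_def)
    show "\<exists>\<eta>0\<le>\<eta>. {\<xi>} \<times> {\<eta>0..\<eta>} \<subseteq> T \<and> norm (Pplus (W (\<xi>, \<eta>0))) \<le> r * (c1 + c2)"
      using z W0'(1)[OF ab(1)] by (intro exI[of _ "- \<xi>"]) (auto simp: T_def)
  qed
  have "norm (K z - wave_combination \<alpha> \<beta> \<gamma> \<delta> N z) \<le> \<epsilon>" if "z \<in> OmegaPlus b" for z
  proof -
    obtain x t where z: "z = (x, t)" by force
    define \<xi> where "\<xi> = (x + t) / 2"
    define \<eta> where "\<eta> = (x - t) / 2"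
    have xt: "x = \<xi> + \<eta>" "t = \<xi> - \<eta>" by (simp_all add: \<xi>_def \<eta>_def field_simps)
    have "0 \<le> \<xi>" "0 \<le> \<eta>" "\<xi> + \<eta> \<le> b"
      using that by (auto simp: z OmegaPlus_def \<xi>_def \<eta>_def field_simps)
    then have tri: "(\<xi>, \<eta>) \<in> char_triangle b" "(\<xi>, \<eta>) \<in> T"
      by (auto simp: char_triangle_def T_def)
    have "K z - wave_combination \<alpha> \<beta> \<gamma> \<delta> N z = W (\<xi>, \<eta>)"
      using G(3)[OF tri(1)] by (simp add: z xt W_def)
    then show ?thesis
      using bound[OF tri(2)] c1 c2 pos by (simp add: r_def flip: E_def)
  qed
  then show ?thesis by (rule that)
qed

end

theorem theorem4p7:
  fixes b :: real and p q f g :: "real \<Rightarrow> complex"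
  assumes "b > 0"
    and "continuous_on {0..b} p" and "continuous_on {0..b} q"
    and "ac_solution b p q f g"
    and "\<forall>x\<in>{0..b}. f x \<noteq> 0 \<and> g x \<noteq> 0"
    and "f 0 * g 0 = 1"
  shows "(\<forall>m. \<forall>W\<in>{O1 p f g m, O2 p f g m, O3 p f g m, O4 p f g m}. classical_solution b p q W) \<and>
    (\<forall>K. mild_solution b p q K \<longrightarrow>
      (\<forall>\<epsilon>>0. \<exists>(N::nat) (a::nat \<Rightarrow> complex) (\<beta>::nat \<Rightarrow> complex) (c::nat \<Rightarrow> complex) (d::nat \<Rightarrow> complex).
        (SUP z\<in>OmegaPlus b.
           norm (K z - (\<Sum>n\<le>N. cscale (a n) (O1 p f g n z) + cscale (\<beta> n) (O2 p f g n z)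
                              + cscale (c n) (O3 p f g n z) + cscale (d n) (O4 p f g n z)))) < \<epsilon>))"
proof -
  interpret nonvanishing_solution b p q f g
    using assms ac_solution_has_vector_derivative[OF assms(4,2,3)] by unfold_locales auto
  show ?thesis
  proof (intro conjI allI impI ballI)
    fix m W assume "W \<in> {O1 p f g m, O2 p f g m, O3 p f g m, O4 p f g m}"
    then show "classical_solution b p q W"
      unfolding classical_solution_iff by (intro solves_on_subset[OF O_solves]) (auto simp: OmegaPlus_def)
  next
    fix K and \<epsilon> :: real assume K: "mild_solution b p q K" and \<epsilon>: "0 < \<epsilon>"
    \<comment> \<open>Half of \<epsilon>, because a supremum inherits only the non-strict
      bound.\<close>
    obtain \<alpha> \<beta> \<gamma> \<delta> N where "\<And>z. z \<in> OmegaPlus b \<Longrightarrow> norm (K z - wave_combination \<alpha> \<beta> \<gamma> \<delta> N z) \<le> \<epsilon> / 2"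
      by (rule wave_matrices_dense[OF K half_gt_zero[OF \<epsilon>]]) (rule that)
    moreover have "(0, 0) \<in> OmegaPlus b" using b by (simp add: OmegaPlus_def)
    ultimately have "(SUP z\<in>OmegaPlus b. norm (K z - wave_combination \<alpha> \<beta> \<gamma> \<delta> N z)) \<le> \<epsilon> / 2"
      by (intro cSUP_least) auto
    also have "\<epsilon> / 2 < \<epsilon>" using \<epsilon> by simp
    finally show "\<exists>(N::nat) (a::nat \<Rightarrow> complex) (\<beta>::nat \<Rightarrow> complex) (c::nat \<Rightarrow> complex) (d::nat \<Rightarrow> complex).
        (SUP z\<in>OmegaPlus b.
           norm (K z - (\<Sum>n\<le>N. cscale (a n) (O1 p f g n z) + cscale (\<beta> n) (O2 p f g n z)
                              + cscale (c n) (O3 p f g n z) + cscale (d n) (O4 p f g n z)))) < \<epsilon>"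
      unfolding wave_combination_def by (intro exI)
  qed
qed

end
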